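(* Let $d\ge4$, $2d\le s\le d^2$, $p\in[1,\infty)$, $N\in\mathbb N$, $T=1$, and $\boldsymbol\xi_i=\mathbf 0_d$ for all $i=1,\dots,N$. Fix a function $\ell:[0,\infty)\to[0,\infty)$ that is monotone increasing with $\ell(0)=0$ and $\ell\not\equiv0$. For some constants $c,c'>0$ depending only on $\ell$, it holds that $$\inf_{\hat{\mathbf A}}\ \sup_{\mathbf A\in\mathbb R^{d\times d}:\ \|\mathbf A\|_0\le s}\mathbb E_{\mathbf A}\left[\ell\left(c\,\psi_p^{-1}\left\|\hat{\mathbf A}-\mathbf A\right\|_p\right)\right]\ge c',\qquad\text{where}\quad\psi_p=s^{1/p}\sqrt{N^{-1}\log(ed^2/s)},$$ and the infimum is taken over all estimators $\hat{\mathbf A}$ of $\mathbf A$.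
   Context: For $\mathbf A\in\mathbb R^{d\times d}$, $\mathbb E_{\mathbf A}$ denotes expectation when the observations $\{\boldsymbol x_i(t):t\in[0,T],\ i=1,\dots,N\}$ are the $\mathbb R^d$-valued solutions of $\mathrm d\boldsymbol x_i(t)=\mathbf A\boldsymbol x_i(t)\,\mathrm dt+\mathrm d\boldsymbol w_i(t)$, $\boldsymbol x_i(0)=\boldsymbol\xi_i$, with $\boldsymbol w_1,\dots,\boldsymbol w_N$ independent $d$-dimensional standard Wiener processes. An estimator is an $\mathbb R^{d\times d}$-valued measurable function of these observations. For a matrix $\mathbf M$, $\|\mathbf M\|_0$ is the number of nonzero entries and $\|\mathbf M\|_p$ is the entrywise $\ell^p$-norm. *)

theory Defs
  imports "HOL-Probability.Probability" "Jordan_Normal_Form.Matrix"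
begin

(* The dimension d is bound inside the theorem (its constants must not depend on d), so
   R^d and R^(d x d) are not rendered by type-indexed vectors: matrices are elements of
   carrier_mat d d, and R^d-valued processes are families of their coordinate processes.
   All indices start at 0. *)

definition l0_norm :: "real mat \<Rightarrow> nat" where
  "l0_norm M = card {(j, k). j < dim_row M \<and> k < dim_col M \<and> M $$ (j, k) \<noteq> 0}"

definition lp_norm :: "real \<Rightarrow> real mat \<Rightarrow> real" where
  "lp_norm p M = (\<Sum>j<dim_row M. \<Sum>k<dim_col M. \<bar>M $$ (j, k)\<bar> powr p) powr (1 / p)"

definition standard_wiener_1d ::
    "'a measure \<Rightarrow> real \<Rightarrow> (real \<Rightarrow> 'a \<Rightarrow> real) \<Rightarrow> bool" where
  "standard_wiener_1d M T w \<longleftrightarrow>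
     (\<forall>t\<in>{0..T}. w t \<in> borel_measurable M) \<and>
     (AE \<omega> in M. w 0 \<omega> = 0) \<and>
     (AE \<omega> in M. continuous_on {0..T} (\<lambda>t. w t \<omega>)) \<and>
     (\<forall>s t. 0 \<le> s \<longrightarrow> s < t \<longrightarrow> t \<le> T \<longrightarrow>
        distributed M lborel (\<lambda>\<omega>. w t \<omega> - w s \<omega>) (normal_density 0 (sqrt (t - s)))) \<and>
     (\<forall>(n::nat) \<tau>. strict_mono_on {..n} \<tau> \<longrightarrow> \<tau> ` {..n} \<subseteq> {0..T} \<longrightarrow>
        prob_space.indep_vars M (\<lambda>_. borel)
          (\<lambda>k \<omega>. w (\<tau> (Suc k)) \<omega> - w (\<tau> k) \<omega>) {..<n})"

definition standard_wiener ::
    "'a measure \<Rightarrow> nat \<Rightarrow> real \<Rightarrow> (nat \<Rightarrow> real \<Rightarrow> 'a \<Rightarrow> real) \<Rightarrow> bool" where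
  "standard_wiener M d T w \<longleftrightarrow>
     (\<forall>j<d. standard_wiener_1d M T (w j)) \<and>
     prob_space.indep_vars M (\<lambda>_. PiM {0..T} (\<lambda>_. borel))
       (\<lambda>j \<omega>. \<lambda>t\<in>{0..T}. w j t \<omega>) {..<d}"

definition independent_wieners ::
    "'a measure \<Rightarrow> nat \<Rightarrow> nat \<Rightarrow> real \<Rightarrow> (nat \<Rightarrow> nat \<Rightarrow> real \<Rightarrow> 'a \<Rightarrow> real) \<Rightarrow> bool" where
  "independent_wieners M N d T w \<longleftrightarrow>
     (\<forall>i<N. standard_wiener M d T (w i)) \<and>
     prob_space.indep_vars M (\<lambda>_. PiM ({..<d} \<times> {0..T}) (\<lambda>_. borel))
       (\<lambda>i \<omega>. \<lambda>(j, t)\<in>{..<d} \<times> {0..T}. w i j t \<omega>) {..<N}"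

(* x i solves dx = A x dt + dw i, x(0) = xi i on [0,T].  The noise is additive, so the
   equation in integrated form involves only the pathwise integral of A x, and no
   stochastic integral. *)
definition ou_solution ::
    "'a measure \<Rightarrow> nat \<Rightarrow> nat \<Rightarrow> real \<Rightarrow> (nat \<Rightarrow> real vec) \<Rightarrow> real mat \<Rightarrow>
     (nat \<Rightarrow> nat \<Rightarrow> real \<Rightarrow> 'a \<Rightarrow> real) \<Rightarrow> (nat \<Rightarrow> nat \<Rightarrow> real \<Rightarrow> 'a \<Rightarrow> real) \<Rightarrow> bool" where
  "ou_solution M N d T \<xi> A w x \<longleftrightarrow>
     (\<forall>i<N. \<forall>j<d.
        (\<forall>t\<in>{0..T}. x i j t \<in> borel_measurable M) \<and>
        (AE \<omega> in M. continuous_on {0..T} (\<lambda>t. x i j t \<omega>)) \<and>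
        (AE \<omega> in M. \<forall>t\<in>{0..T}.
           x i j t \<omega> = vec_index (\<xi> i) j
             + integral {0..t} (\<lambda>u. \<Sum>k<d. A $$ (j, k) * x i k u \<omega>)
             + w i j t \<omega>))"

(* C([0,T]; R^d)^N with the sigma-algebra generated by the evaluations; the value at
   (i, j, t) is coordinate j of x_i(t). *)
definition obs_space :: "nat \<Rightarrow> nat \<Rightarrow> real \<Rightarrow> (nat \<times> nat \<times> real \<Rightarrow> real) measure" where
  "obs_space N d T =
     restrict_space (PiM ({..<N} \<times> {..<d} \<times> {0..T}) (\<lambda>_. borel))
       {y. \<forall>i<N. \<forall>j<d. continuous_on {0..T} (\<lambda>t. y (i, j, t))}"

(* P is the law of the observations under A: on the observation space with measure P, the
   coordinate process is a solution.  Nothing is lost by realising the Wiener processes on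
   this space, since they are the functionals x(t) - x(0) - integral of A x of the path x. *)
definition ou_law ::
    "nat \<Rightarrow> nat \<Rightarrow> real \<Rightarrow> (nat \<Rightarrow> real vec) \<Rightarrow> real mat \<Rightarrow>
     (nat \<times> nat \<times> real \<Rightarrow> real) measure \<Rightarrow> bool" where
  "ou_law N d T \<xi> A P \<longleftrightarrow>
     prob_space P \<and> sets P = sets (obs_space N d T) \<and>
     (\<exists>w. independent_wieners P N d T w \<and>
          ou_solution P N d T \<xi> A w (\<lambda>i j t y. y (i, j, t)))"

definition estimators ::
    "nat \<Rightarrow> nat \<Rightarrow> real \<Rightarrow> ((nat \<times> nat \<times> real \<Rightarrow> real) \<Rightarrow> real mat) set" where
  "estimators N d T =
     {Ahat. (\<forall>y\<in>space (obs_space N d T). Ahat y \<in> carrier_mat d d) \<and>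
            (\<forall>j<d. \<forall>k<d. (\<lambda>y. Ahat y $$ (j, k)) \<in> borel_measurable (obs_space N d T))}"

definition rate :: "real \<Rightarrow> nat \<Rightarrow> nat \<Rightarrow> nat \<Rightarrow> real" where
  "rate p N d s =
     real s powr (1 / p) * sqrt (1 / real N * ln (exp 1 * (real d)\<^sup>2 / real s))"

end

theory Submission
  imports Defs
begin

text \<open>The hypotheses are matrices with square zero: the upper right block of \<open>A\<close> is cut into about \<open>s\<close>
  blocks of \<open>m \<ge> 2\<close> entries lying in a common row, \<open>m\<close> being of order \<open>d\<^sup>2 / s\<close>, and each block has one nonzero entry of size
  \<open>a = sqrt (ln m / N) / 20\<close>.  For such \<open>A\<close> the lower half of the process is a Wiener process, and the
  upper half is an independent Wiener process shifted by an integral of the lower half.  Changing a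
  single entry by \<open>a\<close> is therefore a Cameron-Martin shift by a random but independent direction of mean squared
  length at most \<open>a\<^sup>2 N\<close>, which gives
  \<open>P\<^sub>1 E \<le> exp t * P\<^sub>0 E + (2 / t + 4 / t\<^sup>2) * a\<^sup>2 * N\<close> for every event \<open>E\<close>.  Being an inequality
  without densities, it survives weak limits, so it suffices to have it for Gaussian increments on finite grids,
  where no stochastic integral is needed.

  With \<open>t = ln m / 2\<close> the tests of the \<open>m\<close> possible positions inside one block succeed with
  average probability at most 4/5.  Averaging over all blocks, some hypothesis has at least a
  tenth of its blocks misplaced with probability at least 1/10, and every misplaced block contributes
  at least \<open>(a / 2) powr p\<close> to the \<open>p\<close>-th power of the loss.\<close>

section \<open>Shifted product Gaussians\<close>

text \<open>Square zero makes the model explicit: Picard iteration stops after one step, so the path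
  is a fixed functional of the noise, and the coordinates that feed the drift are noise under every
  hypothesis. Given them, the log-likelihood ratio for one changed entry is Gaussian, but its
  conditional variance is random and unbounded; only its mean is under control, through the second
  moment of a Wiener process. This is why the tail of the likelihood ratio is bounded linearly in
  the squared length of the shift, although exponential decay is available for a fixed shift. The
  \<open>m\<close> alternatives per block, in place of binary ones, produce the logarithm in the
  rate: the events that name the right position are disjoint, so under a common reference they have
  average probability at most \<open>1 / m\<close>, and a factor \<open>exp t = sqrt m\<close> still
  leaves this small. The empty block is the reference because it is one entry away from every
  alternative. The factor 1/20 in \<open>a\<close> is what makes the two error terms add up to at
  most 4/5.\<close>

definition gaussian :: "real \<Rightarrow> real measure" where
  "gaussian \<sigma> = density lborel (normal_density 0 \<sigma>)"

lemma sets_gaussian [simp, measurable_cong]: "sets (gaussian \<sigma>) = sets borel"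
  and space_gaussian [simp]: "space (gaussian \<sigma>) = UNIV"
  by (simp_all add: gaussian_def)

lemma prob_space_gaussian: "\<sigma> > 0 \<Longrightarrow> prob_space (gaussian \<sigma>)"
  unfolding gaussian_def by (rule prob_space_normal_density)

text \<open>One-dimensional Cameron-Martin formula: after the substitution, completing the square
  splits the translated density into the original one and an exponential weight.\<close>

lemma nn_integral_gaussian_shift:
  fixes f :: "real \<Rightarrow> ennreal"
  assumes "\<sigma> > 0" and [measurable]: "f \<in> borel_measurable borel"
  shows "(\<integral>\<^sup>+z. f (z + v) \<partial>gaussian \<sigma>) =
         (\<integral>\<^sup>+z. f z * ennreal (exp (v * z / \<sigma>\<^sup>2 - v\<^sup>2 / (2 * \<sigma>\<^sup>2))) \<partial>gaussian \<sigma>)"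
proof -
  have "(\<integral>\<^sup>+z. f (z + v) \<partial>gaussian \<sigma>) = (\<integral>\<^sup>+z. ennreal (normal_density 0 \<sigma> z) * f (z + v) \<partial>lborel)"
    unfolding gaussian_def by (subst nn_integral_density) auto
  also have "\<dots> = (\<integral>\<^sup>+z. ennreal (normal_density 0 \<sigma> (z - v)) * f z \<partial>lborel)"
    by (subst nn_integral_real_affine[where c = 1 and t = "-v"]) (auto simp: add.commute)
  also have "\<dots> = (\<integral>\<^sup>+z. ennreal (normal_density 0 \<sigma> z) * (f z * ennreal (exp (v * z / \<sigma>\<^sup>2 - v\<^sup>2 / (2 * \<sigma>\<^sup>2)))) \<partial>lborel)"
  proof (intro nn_integral_cong)
    fix z
    have "- (z - v)\<^sup>2 / (2 * \<sigma>\<^sup>2) = - z\<^sup>2 / (2 * \<sigma>\<^sup>2) + (v * z / \<sigma>\<^sup>2 - v\<^sup>2 / (2 * \<sigma>\<^sup>2))"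
      using assms(1) by (simp add: field_simps power2_eq_square)
    then have "normal_density 0 \<sigma> (z - v) =
        normal_density 0 \<sigma> z * exp (v * z / \<sigma>\<^sup>2 - v\<^sup>2 / (2 * \<sigma>\<^sup>2))"
      unfolding normal_density_def by (simp only: diff_zero exp_add mult.assoc)
    then show "ennreal (normal_density 0 \<sigma> (z - v)) * f z =
        ennreal (normal_density 0 \<sigma> z) * (f z * ennreal (exp (v * z / \<sigma>\<^sup>2 - v\<^sup>2 / (2 * \<sigma>\<^sup>2))))"
      by (simp add: ennreal_mult ac_simps)
  qed
  also have "\<dots> = (\<integral>\<^sup>+z. f z * ennreal (exp (v * z / \<sigma>\<^sup>2 - v\<^sup>2 / (2 * \<sigma>\<^sup>2))) \<partial>gaussian \<sigma>)"
    unfolding gaussian_def by (subst nn_integral_density) auto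
  finally show ?thesis .
qed

text \<open>The Radon-Nikodym derivative of the translate of a product Gaussian by \<open>v\<close>.\<close>

definition shift_density :: "real \<Rightarrow> 'i set \<Rightarrow> ('i \<Rightarrow> real) \<Rightarrow> ('i \<Rightarrow> real) \<Rightarrow> real" where
  "shift_density \<sigma> J v z = exp ((\<Sum>c\<in>J. v c * z c) / \<sigma>\<^sup>2 - (\<Sum>c\<in>J. (v c)\<^sup>2) / (2 * \<sigma>\<^sup>2))"

lemma shift_density_prod:
  "finite J \<Longrightarrow> shift_density \<sigma> J v z = (\<Prod>c\<in>J. exp (v c * z c / \<sigma>\<^sup>2 - (v c)\<^sup>2 / (2 * \<sigma>\<^sup>2)))"
  unfolding shift_density_def
  by (simp add: exp_sum[symmetric] sum_subtractf sum_divide_distrib)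

lemma shift_density_measurable [measurable]:
  "finite J \<Longrightarrow> shift_density \<sigma> J v \<in> borel_measurable (PiM J (\<lambda>_. gaussian \<sigma>))"
  unfolding shift_density_def by measurable

lemma product_prob_space_gaussian: "\<sigma> > 0 \<Longrightarrow> product_prob_space (\<lambda>_. gaussian \<sigma>)"
  by (intro product_prob_spaceI prob_space_gaussian)

text \<open>Both sides are identified with a third measure, the product of the translated marginals
  \<open>K c\<close>. It suffices to compare on rectangles, where the density factorises and the
  one-dimensional formula applies to each factor.\<close>

lemma distr_PiM_gaussian_shift:
  fixes v :: "'i \<Rightarrow> real"
  assumes \<sigma>: "\<sigma> > 0" and J: "finite J"
  shows "distr (PiM J (\<lambda>_. gaussian \<sigma>)) (PiM J (\<lambda>_. gaussian \<sigma>)) (\<lambda>z. \<lambda>c\<in>J. z c + v c) =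
         density (PiM J (\<lambda>_. gaussian \<sigma>)) (\<lambda>z. ennreal (shift_density \<sigma> J v z))"
    (is "?D = ?E")
proof -
  interpret product_prob_space "\<lambda>_ :: 'i. gaussian \<sigma>" by (rule product_prob_space_gaussian[OF \<sigma>])
  define K where "K = (\<lambda>c. distr (gaussian \<sigma>) borel (\<lambda>z. z + v c))"
  have K: "prob_space (K c)" for c
    unfolding K_def by (rule prob_space.prob_space_distr[OF prob_space_gaussian[OF \<sigma>]]) simp
  have [measurable_cong]: "sets (K c) = sets borel" for c by (simp add: K_def)
  interpret K: product_prob_space K by (intro product_prob_spaceI K)
  have sh [measurable]: "(\<lambda>z. \<lambda>c\<in>J. z c + v c) \<in> PiM J (\<lambda>_. gaussian \<sigma>) \<rightarrow>\<^sub>M PiM J (\<lambda>_. gaussian \<sigma>)"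
    by (intro measurable_restrict) (auto simp: measurable_cong_sets[OF refl sets_gaussian])
  have sets_eq: "sets (PiM J (\<lambda>_. gaussian \<sigma>)) = sets (PiM J K)"
    by (intro sets_PiM_cong) (auto simp: K_def)
  have "?D = PiM J K"
  proof (rule K.PiM_eqI)
    fix A assume "\<And>i. i \<in> J \<Longrightarrow> A i \<in> sets (K i)"
    then have A [measurable]: "\<And>i. i \<in> J \<Longrightarrow> A i \<in> sets borel" by (simp add: K_def)
    have "emeasure ?D (Pi\<^sub>E J A) =
        emeasure (PiM J (\<lambda>_. gaussian \<sigma>)) ((\<lambda>z. \<lambda>c\<in>J. z c + v c) -` Pi\<^sub>E J A \<inter> space (PiM J (\<lambda>_. gaussian \<sigma>)))"
      by (rule emeasure_distr[OF sh]) (auto intro!: sets_PiM_I_finite J)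
    also have "(\<lambda>z. \<lambda>c\<in>J. z c + v c) -` Pi\<^sub>E J A \<inter> space (PiM J (\<lambda>_. gaussian \<sigma>)) =
        Pi\<^sub>E J (\<lambda>c. (\<lambda>z. z + v c) -` A c)"
      by (auto simp: space_PiM PiE_iff)
    also have "emeasure (PiM J (\<lambda>_. gaussian \<sigma>)) \<dots> = (\<Prod>c\<in>J. emeasure (gaussian \<sigma>) ((\<lambda>z. z + v c) -` A c))"
    proof (intro emeasure_PiM J)
      fix c assume c: "c \<in> J"
      have "(\<lambda>z::real. z + v c) \<in> borel_measurable borel" by measurable
      from measurable_sets_borel[OF this A[OF c]]
      show "(\<lambda>z. z + v c) -` A c \<in> sets (gaussian \<sigma>)" by simp
    qed
    also have "\<dots> = (\<Prod>c\<in>J. emeasure (K c) (A c))"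
      unfolding K_def by (intro prod.cong refl) (subst emeasure_distr, auto)
    finally show "emeasure ?D (Pi\<^sub>E J A) = (\<Prod>i\<in>J. emeasure (K i) (A i))" .
  qed (use J sets_eq in auto)
  also have "PiM J K = ?E"
  proof (rule K.PiM_eqI[symmetric])
    fix A assume "\<And>i. i \<in> J \<Longrightarrow> A i \<in> sets (K i)"
    then have A [measurable]: "\<And>i. i \<in> J \<Longrightarrow> A i \<in> sets borel" by (simp add: K_def)
    have "emeasure ?E (Pi\<^sub>E J A) =
        (\<integral>\<^sup>+z. ennreal (shift_density \<sigma> J v z) * indicator (Pi\<^sub>E J A) z \<partial>PiM J (\<lambda>_. gaussian \<sigma>))"
      using J by (subst emeasure_density) (auto intro!: sets_PiM_I_finite)
    also have "\<dots> = (\<integral>\<^sup>+z. (\<Prod>c\<in>J. ennreal (exp (v c * z c / \<sigma>\<^sup>2 - (v c)\<^sup>2 / (2 * \<sigma>\<^sup>2))) * indicator (A c) (z c))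
        \<partial>PiM J (\<lambda>_. gaussian \<sigma>))"
    proof (intro nn_integral_cong)
      fix z assume "z \<in> space (PiM J (\<lambda>_. gaussian \<sigma>))"
      then have "indicator (Pi\<^sub>E J A) z = (\<Prod>c\<in>J. indicator (A c) (z c) :: ennreal)"
        using J by (auto simp: indicator_def space_PiM PiE_iff prod_zero_iff split: if_splits)
      then show "ennreal (shift_density \<sigma> J v z) * indicator (Pi\<^sub>E J A) z =
          (\<Prod>c\<in>J. ennreal (exp (v c * z c / \<sigma>\<^sup>2 - (v c)\<^sup>2 / (2 * \<sigma>\<^sup>2))) * indicator (A c) (z c))"
        by (simp add: shift_density_prod[OF J] prod.distrib prod_ennreal)
    qed
    also have "\<dots> = (\<Prod>c\<in>J. \<integral>\<^sup>+z. ennreal (exp (v c * z / \<sigma>\<^sup>2 - (v c)\<^sup>2 / (2 * \<sigma>\<^sup>2))) * indicator (A c) z \<partial>gaussian \<sigma>)"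
      by (rule product_nn_integral_prod[OF J]) (auto simp: measurable_cong_sets[OF sets_gaussian refl])
    also have "\<dots> = (\<Prod>c\<in>J. emeasure (K c) (A c))"
    proof (intro prod.cong refl)
      fix c assume c: "c \<in> J"
      have "emeasure (K c) (A c) = (\<integral>\<^sup>+z. indicator (A c) (z + v c) \<partial>gaussian \<sigma>)"
      proof -
        have "emeasure (K c) (A c) = (\<integral>\<^sup>+z. indicator (A c) z \<partial>K c)"
          using A[OF c] by (simp add: K_def)
        also have "\<dots> = (\<integral>\<^sup>+z. indicator (A c) (z + v c) \<partial>gaussian \<sigma>)"
          unfolding K_def using A[OF c] by (intro nn_integral_distr) auto
        finally show ?thesis .
      qed
      also have "\<dots> = (\<integral>\<^sup>+z. ennreal (exp (v c * z / \<sigma>\<^sup>2 - (v c)\<^sup>2 / (2 * \<sigma>\<^sup>2))) * indicator (A c) z \<partial>gaussian \<sigma>)"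
        using A[OF c] by (subst nn_integral_gaussian_shift[OF \<sigma>]) (auto simp: mult.commute)
      finally show "(\<integral>\<^sup>+z. ennreal (exp (v c * z / \<sigma>\<^sup>2 - (v c)\<^sup>2 / (2 * \<sigma>\<^sup>2))) * indicator (A c) z \<partial>gaussian \<sigma>) =
          emeasure (K c) (A c)" by simp
    qed
    finally show "emeasure ?E (Pi\<^sub>E J A) = (\<Prod>i\<in>J. emeasure (K i) (A i))" .
  qed (use J sets_eq in auto)
  finally show ?thesis .
qed

lemma nn_integral_PiM_gaussian_shift:
  assumes \<sigma>: "\<sigma> > 0" and J: "finite J"
    and [measurable]: "G \<in> borel_measurable (PiM J (\<lambda>_. gaussian \<sigma>))"
  shows "(\<integral>\<^sup>+z. G (\<lambda>c\<in>J. z c + v c) \<partial>PiM J (\<lambda>_. gaussian \<sigma>)) =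
         (\<integral>\<^sup>+z. ennreal (shift_density \<sigma> J v z) * G z \<partial>PiM J (\<lambda>_. gaussian \<sigma>))"
proof -
  have sh [measurable]: "(\<lambda>z. \<lambda>c\<in>J. z c + v c) \<in> PiM J (\<lambda>_. gaussian \<sigma>) \<rightarrow>\<^sub>M PiM J (\<lambda>_. gaussian \<sigma>)"
    by (intro measurable_restrict) (auto simp: measurable_cong_sets[OF refl sets_gaussian])
  have "(\<integral>\<^sup>+z. G (\<lambda>c\<in>J. z c + v c) \<partial>PiM J (\<lambda>_. gaussian \<sigma>)) =
     (\<integral>\<^sup>+z. G z \<partial>distr (PiM J (\<lambda>_. gaussian \<sigma>)) (PiM J (\<lambda>_. gaussian \<sigma>)) (\<lambda>z. \<lambda>c\<in>J. z c + v c))"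
    by (subst nn_integral_distr) auto
  then show ?thesis
    unfolding distr_PiM_gaussian_shift[OF \<sigma> J] using J by (subst (asm) nn_integral_density) auto
qed

text \<open>A Chernoff bound for the log-likelihood ratio, weakened to a bound that is linear in the
  squared length of the shift, so that it can be averaged over a random shift.\<close>

lemma shift_density_tail:
  fixes v :: "'i \<Rightarrow> real"
  assumes \<sigma>: "\<sigma> > 0" and J: "finite J" and t: "t > 0"
  defines "V \<equiv> (\<Sum>c\<in>J. (v c)\<^sup>2) / \<sigma>\<^sup>2"
  shows "(\<integral>\<^sup>+z. ennreal (shift_density \<sigma> J v z) * indicator {z. shift_density \<sigma> J v z > exp t} z
            \<partial>PiM J (\<lambda>_. gaussian \<sigma>)) \<le> ennreal ((2 / t + 4 / t\<^sup>2) * V)"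
proof -
  let ?\<nu> = "PiM J (\<lambda>_. gaussian \<sigma>)"
  let ?L = "shift_density \<sigma> J v"
  interpret product_prob_space "\<lambda>_ :: 'i. gaussian \<sigma>" by (rule product_prob_space_gaussian[OF \<sigma>])
  have one: "(\<integral>\<^sup>+z. ennreal (shift_density \<sigma> J u z) \<partial>?\<nu>) = 1" for u
    using nn_integral_PiM_gaussian_shift[OF \<sigma> J, of "\<lambda>_. 1" u]
    by (simp add: prob_space.emeasure_space_1[OF prob_space_PiM[OF prob_space_gaussian[OF \<sigma>]]])
  have V0: "V \<ge> 0" unfolding V_def by (auto intro!: divide_nonneg_nonneg sum_nonneg)
  \<comment> \<open>Under the translated measure the log-likelihood ratio is Gaussian with mean
    \<open>V / 2\<close> and variance \<open>V\<close>. Exponential moments help only while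
    \<open>t\<close> is well above this mean. For \<open>V > t / 2\<close> the claimed bound exceeds
    1 and holds trivially; for \<open>V = 0\<close> the ratio is constantly 1.\<close>
  consider "V = 0" | "V > t / 2" | "0 < V" "V \<le> t / 2" using V0 by linarith
  then show ?thesis
  proof cases
    case 1
    then have "v c = 0" if "c \<in> J" for c
      using \<sigma> J that unfolding V_def by (simp add: sum_nonneg_eq_0_iff)
    then have "?L z = 1" for z by (simp add: shift_density_def)
    then have "\<not> ?L z > exp t" for z using t by simp
    then show ?thesis by simp
  next
    case 2
    have "(\<integral>\<^sup>+z. ennreal (?L z) * indicator {z. ?L z > exp t} z \<partial>?\<nu>) \<le> (\<integral>\<^sup>+z. ennreal (?L z) \<partial>?\<nu>)"
      by (intro nn_integral_mono) (auto simp: indicator_def)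
    also have "\<dots> = ennreal 1" using one by simp
    also have "1 \<le> (2 / t + 4 / t\<^sup>2) * V"
    proof -
      have "1 \<le> 2 / t * V" using 2 t by (simp add: field_simps)
      also have "\<dots> \<le> (2 / t + 4 / t\<^sup>2) * V" using V0 t by (intro mult_right_mono) auto
      finally show ?thesis .
    qed
    finally show ?thesis by (simp add: ennreal_leI)
  next
    case 3
    \<comment> \<open>Exponent of the Chernoff bound. The optimum would be
      \<open>t / V - 1 / 2\<close>; this nearby value gives \<open>(s + 1) * V = t\<close>, so that
      the exponent collapses to \<open>- (s * t / 2)\<close>.\<close>
    define s where "s = t / V - 1"
    have s: "s \<ge> 0" using 3 t by (simp add: s_def field_simps)
    have sq: "(\<Sum>c\<in>J. (v c)\<^sup>2) = V * \<sigma>\<^sup>2" using \<sigma> by (simp add: V_def)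
    define u where "u = (\<lambda>c. (1 + s) * v c)"
    have sqs: "(\<Sum>c\<in>J. ((1 + s) * v c)\<^sup>2) = (1 + s)\<^sup>2 * (V * \<sigma>\<^sup>2)"
      by (simp add: power_mult_distrib sum_distrib_left[symmetric] sq)
    \<comment> \<open>On the event, \<open>?L z\<close> is at most its power with exponent
      \<open>1 + s\<close> times \<open>exp (- s * t)\<close>. That power is again a translate
      density, for the shift \<open>u\<close>, up to the factor
      \<open>exp (s * (s + 1) * V / 2)\<close>, and therefore has an explicit integral.\<close>
    have pt: "?L z * indicator {z. ?L z > exp t} z \<le> shift_density \<sigma> J u z * exp (s * (s + 1) * V / 2 - s * t)" for z
    proof (cases "?L z > exp t")
      case True
      define Y where "Y = (\<Sum>c\<in>J. v c * z c) / \<sigma>\<^sup>2"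
      have L: "?L z = exp (Y - V / 2)"
        unfolding shift_density_def sq Y_def using \<sigma> by simp
      have Lu: "shift_density \<sigma> J u z = exp ((1 + s) * Y - (1 + s)\<^sup>2 * V / 2)"
        unfolding shift_density_def u_def sqs Y_def using \<sigma>
        by (simp add: mult.assoc sum_distrib_left[symmetric])
      have "Y - V / 2 > t" using True L by simp
      then have "s * t \<le> s * (Y - V / 2)" using s by (intro mult_left_mono) auto
      then have "Y - V / 2 \<le> (1 + s) * Y - (1 + s)\<^sup>2 * V / 2 + (s * (s + 1) * V / 2 - s * t)"
        by (simp add: power2_eq_square algebra_simps add_divide_distrib)
      then show ?thesis using True by (simp add: L Lu exp_add[symmetric])
    qed (simp add: shift_density_def)
    have "(\<integral>\<^sup>+z. ennreal (?L z) * indicator {z. ?L z > exp t} z \<partial>?\<nu>) \<le>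
        (\<integral>\<^sup>+z. ennreal (shift_density \<sigma> J u z) * ennreal (exp (s * (s + 1) * V / 2 - s * t)) \<partial>?\<nu>)"
    proof (intro nn_integral_mono)
      fix z
      have "ennreal (?L z) * indicator {z. ?L z > exp t} z = ennreal (?L z * indicator {z. ?L z > exp t} z)"
        by (simp add: indicator_def)
      also have "\<dots> \<le> ennreal (shift_density \<sigma> J u z * exp (s * (s + 1) * V / 2 - s * t))"
        by (intro ennreal_leI pt)
      finally show "ennreal (?L z) * indicator {z. ?L z > exp t} z
          \<le> ennreal (shift_density \<sigma> J u z) * ennreal (exp (s * (s + 1) * V / 2 - s * t))"
        by (simp add: ennreal_mult shift_density_def)
    qed
    also have "\<dots> = ennreal (exp (s * (s + 1) * V / 2 - s * t))"
      using J by (subst nn_integral_multc) (auto simp: one)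
    also have "exp (s * (s + 1) * V / 2 - s * t) \<le> (2 / t + 4 / t\<^sup>2) * V"
    proof -
      \<comment> \<open>\<open>V \<le> t / 2\<close> gives \<open>t / (2 * V) \<le> s\<close>, hence
        an exponent of at most \<open>- x\<close>. The estimate \<open>exp (- x) \<le> 1 / x\<close>
        then exchanges exponential decay for linearity in \<open>V\<close>.\<close>
      define x where "x = t\<^sup>2 / (4 * V)"
      have x: "x > 0" using 3 t by (simp add: x_def)
      have "(s + 1) * V = t" using 3 by (simp add: s_def)
      then have "s * (s + 1) * V / 2 - s * t = - (s * t / 2)"
        by (simp add: mult.assoc)
      also have "\<dots> \<le> - x"
      proof -
        have "t / (2 * V) \<le> s" using 3 t by (simp add: s_def field_simps)
        then have "t / (2 * V) * t / 2 \<le> s * t / 2" using t by (intro divide_right_mono mult_right_mono) auto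
        then show ?thesis using 3 by (simp add: x_def power2_eq_square)
      qed
      finally have "exp (s * (s + 1) * V / 2 - s * t) \<le> exp (- x)" by simp
      also have "\<dots> \<le> 1 / x"
      proof -
        have "x \<le> exp x" using exp_ge_add_one_self[of x] by linarith
        then have "inverse (exp x) \<le> inverse x" using x by (intro le_imp_inverse_le) auto
        then show ?thesis by (simp add: exp_minus divide_inverse)
      qed
      also have "\<dots> = 4 / t\<^sup>2 * V" using 3 t by (simp add: x_def)
      also have "\<dots> \<le> (2 / t + 4 / t\<^sup>2) * V" using V0 t by (intro mult_right_mono) auto
      finally show ?thesis .
    qed
    finally show ?thesis by (simp add: ennreal_leI)
  qed
qed

text \<open>Truncation of the likelihood ratio at \<open>exp t\<close>: below this level the ratio
  is replaced by \<open>exp t\<close>, above it \<open>G\<close> is replaced by 1 and the tail bound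
  takes over.\<close>

lemma gaussian_shift_le:
  assumes \<sigma>: "\<sigma> > 0" and J: "finite J" and t: "t > 0"
    and G [measurable]: "G \<in> borel_measurable (PiM J (\<lambda>_. gaussian \<sigma>))"
    and G1: "\<And>z. z \<in> space (PiM J (\<lambda>_. gaussian \<sigma>)) \<Longrightarrow> G z \<le> 1"
  shows "(\<integral>\<^sup>+z. G (\<lambda>c\<in>J. z c + v c) \<partial>PiM J (\<lambda>_. gaussian \<sigma>)) \<le>
         ennreal (exp t) * (\<integral>\<^sup>+z. G z \<partial>PiM J (\<lambda>_. gaussian \<sigma>)) +
         ennreal ((2 / t + 4 / t\<^sup>2) / \<sigma>\<^sup>2 * (\<Sum>c\<in>J. (v c)\<^sup>2))"
proof -
  let ?\<nu> = "PiM J (\<lambda>_. gaussian \<sigma>)"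
  let ?L = "shift_density \<sigma> J v"
  have [measurable]: "?L \<in> borel_measurable ?\<nu>" by (rule shift_density_measurable[OF J])
  have "(\<integral>\<^sup>+z. G (\<lambda>c\<in>J. z c + v c) \<partial>?\<nu>) = (\<integral>\<^sup>+z. ennreal (?L z) * G z \<partial>?\<nu>)"
    by (rule nn_integral_PiM_gaussian_shift[OF \<sigma> J G])
  also have "\<dots> \<le> (\<integral>\<^sup>+z. ennreal (exp t) * G z + ennreal (?L z) * indicator {z. ?L z > exp t} z \<partial>?\<nu>)"
  proof (intro nn_integral_mono)
    fix z assume z: "z \<in> space ?\<nu>"
    show "ennreal (?L z) * G z \<le> ennreal (exp t) * G z + ennreal (?L z) * indicator {z. ?L z > exp t} z"
    proof (cases "?L z > exp t")
      case True
      have "ennreal (?L z) * G z \<le> ennreal (?L z) * 1" by (intro mult_left_mono G1 z) auto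
      also have "\<dots> \<le> ennreal (exp t) * G z + ennreal (?L z)" by simp
      finally show ?thesis using True by simp
    next
      case False
      then show ?thesis by (auto intro!: mult_right_mono ennreal_leI add_increasing2)
    qed
  qed
  also have "\<dots> = ennreal (exp t) * (\<integral>\<^sup>+z. G z \<partial>?\<nu>) +
      (\<integral>\<^sup>+z. ennreal (?L z) * indicator {z. ?L z > exp t} z \<partial>?\<nu>)"
  proof -
    have "(\<lambda>z. ennreal (?L z) * indicator {z. ?L z > exp t} z) \<in> borel_measurable ?\<nu>"
      by (intro borel_measurable_times_ennreal borel_measurable_indicator') measurable
    then show ?thesis by (subst nn_integral_add) (auto simp: nn_integral_cmult)
  qed
  also have "\<dots> \<le> ennreal (exp t) * (\<integral>\<^sup>+z. G z \<partial>?\<nu>) + ennreal ((2 / t + 4 / t\<^sup>2) * ((\<Sum>c\<in>J. (v c)\<^sup>2) / \<sigma>\<^sup>2))"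
    by (intro add_left_mono shift_density_tail[OF \<sigma> J t])
  finally show ?thesis by simp
qed

text \<open>By Fubini the coordinates in \<open>R\<close> are frozen. \<open>S_dep\<close> makes the
  shift of the coordinates in \<open>J\<close> constant in the inner integral, so the bound for
  deterministic shifts applies there; being linear in the squared length, it can be integrated over
  \<open>R\<close>.\<close>

lemma gaussian_random_shift_le:
  fixes S :: "'i \<Rightarrow> ('i \<Rightarrow> real) \<Rightarrow> real"
  assumes \<sigma>: "\<sigma> > 0" and R: "finite R" and J: "finite J" and RJ: "R \<inter> J = {}" and t: "t > 0"
    and G [measurable]: "G \<in> borel_measurable (PiM (R \<union> J) (\<lambda>_. gaussian \<sigma>))"
    and G1: "\<And>z. z \<in> space (PiM (R \<union> J) (\<lambda>_. gaussian \<sigma>)) \<Longrightarrow> G z \<le> 1"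
    and S_meas [measurable]: "\<And>c. c \<in> J \<Longrightarrow> S c \<in> borel_measurable (PiM R (\<lambda>_. gaussian \<sigma>))"
    and S_dep: "\<And>c z. c \<in> J \<Longrightarrow> S c z = S c (restrict z R)"
  shows "(\<integral>\<^sup>+z. G (\<lambda>c\<in>R \<union> J. z c + (if c \<in> J then S c z else 0)) \<partial>PiM (R \<union> J) (\<lambda>_. gaussian \<sigma>)) \<le>
         ennreal (exp t) * (\<integral>\<^sup>+z. G z \<partial>PiM (R \<union> J) (\<lambda>_. gaussian \<sigma>)) +
         ennreal ((2 / t + 4 / t\<^sup>2) / \<sigma>\<^sup>2) *
           (\<integral>\<^sup>+z. ennreal (\<Sum>c\<in>J. (S c z)\<^sup>2) \<partial>PiM (R \<union> J) (\<lambda>_. gaussian \<sigma>))"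
proof -
  interpret product_prob_space "\<lambda>_ :: 'i. gaussian \<sigma>" by (rule product_prob_space_gaussian[OF \<sigma>])
  let ?R = "PiM R (\<lambda>_. gaussian \<sigma>)" and ?J = "PiM J (\<lambda>_. gaussian \<sigma>)"
  let ?I = "PiM (R \<union> J) (\<lambda>_. gaussian \<sigma>)"
  define K where "K = (2 / t + 4 / t\<^sup>2) / \<sigma>\<^sup>2"
  have K0: "K \<ge> 0" using t by (simp add: K_def)
  have S_meas' [measurable]: "S c \<in> borel_measurable ?I" if c: "c \<in> J" for c
  proof -
    have "(\<lambda>z. S c (restrict z R)) \<in> borel_measurable ?I"
      by (rule measurable_compose[OF measurable_restrict_subset S_meas[OF c]]) auto
    then show ?thesis using S_dep[OF c] by (metis (no_types, lifting) measurable_cong)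
  qed
  have shI: "(\<lambda>z. \<lambda>c\<in>R \<union> J. z c + (if c \<in> J then S c z else 0)) \<in> ?I \<rightarrow>\<^sub>M ?I"
  proof (intro measurable_restrict)
    fix c assume "c \<in> R \<union> J"
    then show "(\<lambda>z. z c + (if c \<in> J then S c z else 0)) \<in> ?I \<rightarrow>\<^sub>M gaussian \<sigma>"
      by (cases "c \<in> J") (auto simp: measurable_cong_sets[OF refl sets_gaussian]
          intro!: borel_measurable_add measurable_component_singleton S_meas' 
          measurable_compose[OF measurable_component_singleton])
  qed
  have fold: "(\<integral>\<^sup>+z. f z \<partial>?I) = (\<integral>\<^sup>+x. \<integral>\<^sup>+y. f (merge R J (x, y)) \<partial>?J \<partial>?R)"
    if "f \<in> borel_measurable ?I" for f
    by (rule product_nn_integral_fold[OF RJ R J that])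
  have Gm: "(\<lambda>y. G (merge R J (x, y))) \<in> borel_measurable ?J" if "x \<in> space ?R" for x
    using measurable_compose[OF measurable_Pair1'[OF that] measurable_compose[OF measurable_merge G]] by simp
  have Gm2: "(\<lambda>x. \<integral>\<^sup>+y. G (merge R J (x, y)) \<partial>?J) \<in> borel_measurable ?R"
  proof -
    interpret J: prob_space ?J by (intro prob_space_PiM prob_space_gaussian \<sigma>)
    show ?thesis by measurable
  qed
  have eqS: "S c (merge R J (x, y)) = S c x" if "x \<in> space ?R" "c \<in> J" for x y c
  proof -
    have "restrict (merge R J (x, y)) R = restrict x R" using RJ by (auto simp: merge_def)
    then show ?thesis using S_dep[OF that(2)] by metis
  qed
  have "(\<integral>\<^sup>+z. G (\<lambda>c\<in>R \<union> J. z c + (if c \<in> J then S c z else 0)) \<partial>?I) =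
     (\<integral>\<^sup>+x. \<integral>\<^sup>+y. G (\<lambda>c\<in>R \<union> J. merge R J (x, y) c + (if c \<in> J then S c (merge R J (x, y)) else 0)) \<partial>?J \<partial>?R)"
    by (rule fold) (rule measurable_compose[OF shI G])
  also have "\<dots> = (\<integral>\<^sup>+x. \<integral>\<^sup>+y. G (merge R J (x, \<lambda>c\<in>J. y c + S c x)) \<partial>?J \<partial>?R)"
  proof (intro nn_integral_cong arg_cong[where f = G])
    fix x y assume x: "x \<in> space ?R" and "y \<in> space ?J"
    show "(\<lambda>c\<in>R \<union> J. merge R J (x, y) c + (if c \<in> J then S c (merge R J (x, y)) else 0)) =
        merge R J (x, \<lambda>c\<in>J. y c + S c x)"
    proof (rule ext)
      fix c
      show "(\<lambda>c\<in>R \<union> J. merge R J (x, y) c + (if c \<in> J then S c (merge R J (x, y)) else 0)) c =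
          merge R J (x, \<lambda>c\<in>J. y c + S c x) c"
        using RJ eqS[OF x, of c y] by (cases "c \<in> J") (auto simp: merge_def)
    qed
  qed
  also have "\<dots> \<le> (\<integral>\<^sup>+x. ennreal (exp t) * (\<integral>\<^sup>+y. G (merge R J (x, y)) \<partial>?J) +
      ennreal K * ennreal (\<Sum>c\<in>J. (S c x)\<^sup>2) \<partial>?R)"
  proof (intro nn_integral_mono)
    fix x assume x: "x \<in> space ?R"
    have "(\<integral>\<^sup>+y. G (merge R J (x, \<lambda>c\<in>J. y c + S c x)) \<partial>?J) \<le>
        ennreal (exp t) * (\<integral>\<^sup>+y. G (merge R J (x, y)) \<partial>?J) +
        ennreal ((2 / t + 4 / t\<^sup>2) / \<sigma>\<^sup>2 * (\<Sum>c\<in>J. (S c x)\<^sup>2))"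
    proof (rule gaussian_shift_le[OF \<sigma> J t Gm[OF x]])
      fix z assume "z \<in> space ?J"
      then have "merge R J (x, z) \<in> space ?I"
        using x RJ by (auto simp: space_PiM PiE_iff merge_def extensional_def)
      then show "G (merge R J (x, z)) \<le> 1" by (rule G1)
    qed
    also have "ennreal ((2 / t + 4 / t\<^sup>2) / \<sigma>\<^sup>2 * (\<Sum>c\<in>J. (S c x)\<^sup>2)) = ennreal K * ennreal (\<Sum>c\<in>J. (S c x)\<^sup>2)"
      unfolding K_def[symmetric] by (intro ennreal_mult K0 sum_nonneg) simp
    finally show "(\<integral>\<^sup>+y. G (merge R J (x, \<lambda>c\<in>J. y c + S c x)) \<partial>?J) \<le>
        ennreal (exp t) * (\<integral>\<^sup>+y. G (merge R J (x, y)) \<partial>?J) + ennreal K * ennreal (\<Sum>c\<in>J. (S c x)\<^sup>2)" .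
  qed
  also have "\<dots> = ennreal (exp t) * (\<integral>\<^sup>+x. \<integral>\<^sup>+y. G (merge R J (x, y)) \<partial>?J \<partial>?R) +
      ennreal K * (\<integral>\<^sup>+x. ennreal (\<Sum>c\<in>J. (S c x)\<^sup>2) \<partial>?R)"
    using Gm2 by (subst nn_integral_add) (auto simp: nn_integral_cmult)
  also have "(\<integral>\<^sup>+x. \<integral>\<^sup>+y. G (merge R J (x, y)) \<partial>?J \<partial>?R) = (\<integral>\<^sup>+z. G z \<partial>?I)"
    by (rule fold[OF G, symmetric])
  also have "(\<integral>\<^sup>+x. ennreal (\<Sum>c\<in>J. (S c x)\<^sup>2) \<partial>?R) = (\<integral>\<^sup>+z. ennreal (\<Sum>c\<in>J. (S c z)\<^sup>2) \<partial>?I)"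
  proof -
    interpret J: prob_space ?J by (intro prob_space_PiM prob_space_gaussian \<sigma>)
    have "(\<integral>\<^sup>+z. ennreal (\<Sum>c\<in>J. (S c z)\<^sup>2) \<partial>?I) =
        (\<integral>\<^sup>+x. \<integral>\<^sup>+y. ennreal (\<Sum>c\<in>J. (S c (merge R J (x, y)))\<^sup>2) \<partial>?J \<partial>?R)"
      by (rule fold) measurable
    also have "\<dots> = (\<integral>\<^sup>+x. \<integral>\<^sup>+y. ennreal (\<Sum>c\<in>J. (S c x)\<^sup>2) \<partial>?J \<partial>?R)"
      by (intro nn_integral_cong arg_cong[where f = ennreal] sum.cong refl) (simp add: eqS)
    finally show ?thesis by (simp add: J.emeasure_space_1)
  qed
  finally show ?thesis unfolding K_def .
qed

section \<open>Approximation of events by continuous functionals\<close>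

text \<open>Test functions for convergence of all coordinates of a path. Continuity is sequential,
  as dominated convergence uses it, and measurability for the product sigma-algebra is demanded
  separately because \<open>I\<close> may be uncountable. The points \<open>y\<close> are arbitrary
  functions, so that values outside \<open>I\<close> need no normalisation.\<close>

definition cylinder_continuous :: "'i set \<Rightarrow> (('i \<Rightarrow> real) \<Rightarrow> real) \<Rightarrow> bool" where
  "cylinder_continuous I F \<longleftrightarrow>
     F \<in> borel_measurable (PiM I (\<lambda>_. borel)) \<and>
     (\<forall>y. 0 \<le> F y \<and> F y \<le> 1) \<and>
     (\<forall>Y y. (\<forall>c\<in>I. (\<lambda>n::nat. Y n c) \<longlonglongrightarrow> y c) \<longrightarrow> (\<lambda>n. F (Y n)) \<longlonglongrightarrow> F y)"

lemma cylinder_continuousD: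
  assumes "cylinder_continuous I F"
  shows "F \<in> borel_measurable (PiM I (\<lambda>_. borel))" "0 \<le> F y" "F y \<le> 1"
    "(\<And>c. c \<in> I \<Longrightarrow> (\<lambda>n. Y n c) \<longlonglongrightarrow> y c) \<Longrightarrow> (\<lambda>n. F (Y n)) \<longlonglongrightarrow> F y"
  using assms unfolding cylinder_continuous_def by auto

lemma cylinder_continuous_const: "0 \<le> a \<Longrightarrow> a \<le> 1 \<Longrightarrow> cylinder_continuous I (\<lambda>_. a)"
  unfolding cylinder_continuous_def by auto

lemma cylinder_continuous_compl: "cylinder_continuous I F \<Longrightarrow> cylinder_continuous I (\<lambda>y. 1 - F y)"
  unfolding cylinder_continuous_def by (auto intro!: tendsto_intros)

lemma cylinder_continuous_prod:
  assumes "\<And>k. k \<in> K \<Longrightarrow> cylinder_continuous I (F k)"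
  shows "cylinder_continuous I (\<lambda>y. \<Prod>k\<in>K. F k y)"
  using assms unfolding cylinder_continuous_def
  by (auto intro!: tendsto_prod borel_measurable_prod prod_nonneg prod_le_1)

text \<open>A single \<open>F\<close> has to serve both measures, because the inequality to be
  transferred compares the integrals of one function under \<open>P\<close> and under
  \<open>Q\<close>.\<close>

definition approximable :: "'i set \<Rightarrow> ('i \<Rightarrow> real) measure \<Rightarrow> ('i \<Rightarrow> real) measure \<Rightarrow> ('i \<Rightarrow> real) set \<Rightarrow> bool" where
  "approximable I P Q E \<longleftrightarrow> (\<forall>\<epsilon>>0. \<exists>F. cylinder_continuous I F \<and>
     (\<integral>y. \<bar>indicator E y - F y\<bar> \<partial>P) < \<epsilon> \<and> (\<integral>y. \<bar>indicator E y - F y\<bar> \<partial>Q) < \<epsilon>)"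

context
  fixes I :: "'i set" and P Q :: "('i \<Rightarrow> real) measure"
  assumes P: "prob_space P" and Q: "prob_space Q"
    and sets_P: "sets P = sets (PiM I (\<lambda>_. borel))" and sets_Q: "sets Q = sets (PiM I (\<lambda>_. borel))"
begin

private abbreviation "B \<equiv> PiM I (\<lambda>_. borel :: real measure)"

private lemma integrable_approx:
  assumes "prob_space M" "sets M = sets B" "E \<in> sets B" "cylinder_continuous I F"
  shows "integrable M (\<lambda>y. \<bar>indicator E y - F y\<bar>)"
proof -
  interpret prob_space M by fact
  have [measurable]: "F \<in> borel_measurable M"
    using cylinder_continuousD(1)[OF assms(4)] by (simp add: measurable_cong_sets[OF assms(2) refl])
  have [measurable]: "E \<in> sets M" using assms by simp
  show ?thesis
  proof (rule integrable_const_bound[where B = 1])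
    show "AE y in M. norm \<bar>indicator E y - F y\<bar> \<le> 1"
    proof (intro AE_I2)
      fix y
      show "norm \<bar>indicator E y - F y\<bar> \<le> 1"
        using cylinder_continuousD(2,3)[OF assms(4), of y] by (auto simp: indicator_def)
    qed
  qed measurable
qed

text \<open>\<open>1 - (\<Prod>k<n. 1 - F k y)\<close> is the continuous counterpart of the
  indicator of a finite union. Factors in the unit interval make the product 1-Lipschitz in each of
  them, so the errors only add up; the first summand of the bound pays for the sets from index
  \<open>n\<close> on.\<close>

private lemma approx_UN_bound:
  fixes A :: "nat \<Rightarrow> ('i \<Rightarrow> real) set"
  assumes M: "prob_space M" "sets M = sets B" and A: "\<And>k. A k \<in> sets B"
    and F: "\<And>k. cylinder_continuous I (F k)"
    and le: "\<And>k. k < n \<Longrightarrow> (\<integral>y. \<bar>indicator (A k) y - F k y\<bar> \<partial>M) \<le> \<epsilon>"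
  shows "(\<integral>y. \<bar>indicator (\<Union>k. A k) y - (1 - (\<Prod>k<n. 1 - F k y))\<bar> \<partial>M) \<le>
     (measure M (\<Union>k. A k) - measure M (\<Union>k<n. A k)) + real n * \<epsilon>"
proof -
  interpret prob_space M by (rule M(1))
  have A' [measurable]: "A k \<in> sets M" for k using A M(2) by simp
  have C: "cylinder_continuous I (\<lambda>y. 1 - (\<Prod>k<n. 1 - F k y))"
    by (intro cylinder_continuous_compl cylinder_continuous_prod F)
  have U: "(\<Union>k. A k) \<in> sets B" using A by auto
  have int: "integrable M (\<lambda>y. \<bar>indicator (A k) y - F k y\<bar>)" for k
    by (rule integrable_approx[OF M A F])
  have D: "(\<Union>k. A k) - (\<Union>k<n. A k) \<in> sets M" using A' by auto
  have intD: "integrable M (indicator ((\<Union>k. A k) - (\<Union>k<n. A k)) :: _ \<Rightarrow> real)"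
    by (intro integrable_real_indicator D) (simp add: emeasure_eq_measure)
  have pt: "\<bar>indicator (\<Union>k. A k) y - (1 - (\<Prod>k<n. 1 - F k y))\<bar> \<le>
      indicator ((\<Union>k. A k) - (\<Union>k<n. A k)) y + (\<Sum>k<n. \<bar>indicator (A k) y - F k y\<bar>)" for y
  proof -
    have "norm ((\<Prod>k<n. 1 - F k y) - (\<Prod>k<n. 1 - indicator (A k) y :: real)) \<le>
        (\<Sum>k<n. norm ((1 - F k y) - (1 - indicator (A k) y)))"
      using cylinder_continuousD(2,3)[OF F] by (intro norm_prod_diff) (auto simp: indicator_def)
    also have "(\<Prod>k<n. 1 - indicator (A k) y :: real) = 1 - indicator (\<Union>k<n. A k) y"
      by (auto simp: indicator_def prod_zero_iff intro!: prod.neutral)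
    finally have "\<bar>(\<Prod>k<n. 1 - F k y) - (1 - indicator (\<Union>k<n. A k) y)\<bar> \<le> (\<Sum>k<n. \<bar>indicator (A k) y - F k y\<bar>)"
      by simp
    moreover have "indicator (\<Union>k. A k) y = (indicator (\<Union>k<n. A k) y + indicator ((\<Union>k. A k) - (\<Union>k<n. A k)) y :: real)"
      by (auto simp: indicator_def)
    moreover have "(0::real) \<le> indicator ((\<Union>k. A k) - (\<Union>k<n. A k)) y" by simp
    ultimately show ?thesis by linarith
  qed
  have "(\<integral>y. \<bar>indicator (\<Union>k. A k) y - (1 - (\<Prod>k<n. 1 - F k y))\<bar> \<partial>M) \<le>
     (\<integral>y. indicator ((\<Union>k. A k) - (\<Union>k<n. A k)) y + (\<Sum>k<n. \<bar>indicator (A k) y - F k y\<bar>) \<partial>M)"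
    by (intro integral_mono pt integrable_approx[OF M U C] Bochner_Integration.integrable_add
        Bochner_Integration.integrable_sum int intD)
  also have "\<dots> = measure M ((\<Union>k. A k) - (\<Union>k<n. A k)) + (\<Sum>k<n. \<integral>y. \<bar>indicator (A k) y - F k y\<bar> \<partial>M)"
    by (subst Bochner_Integration.integral_add)
       (auto intro!: Bochner_Integration.integrable_sum int intD Bochner_Integration.integral_sum
         simp: D)
  also have "measure M ((\<Union>k. A k) - (\<Union>k<n. A k)) = measure M (\<Union>k. A k) - measure M (\<Union>k<n. A k)"
    by (rule finite_measure_Diff) auto
  also have "(\<Sum>k<n. \<integral>y. \<bar>indicator (A k) y - F k y\<bar> \<partial>M) \<le> real n * \<epsilon>"
    using sum_bounded_above[of "{..<n}" "\<lambda>k. \<integral>y. \<bar>indicator (A k) y - F k y\<bar> \<partial>M" \<epsilon>] le by simp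
  finally show ?thesis by simp
qed

private lemma measure_UN_lessThan_tendsto:
  assumes M: "prob_space M" "sets M = sets B" and A: "\<And>k. A k \<in> sets B"
  shows "(\<lambda>n. measure M (\<Union>k. A k) - measure M (\<Union>k<n::nat. A k)) \<longlonglongrightarrow> 0"
proof -
  interpret prob_space M by (rule M(1))
  have "(\<lambda>n. measure M (\<Union>k<n. A k)) \<longlonglongrightarrow> measure M (\<Union>n. \<Union>k<n. A k)"
    using A M(2) by (intro finite_Lim_measure_incseq) (auto simp: incseq_def intro: less_le_trans)
  also have "(\<Union>n. \<Union>k<n. A k) = (\<Union>k. A k)" by auto
  finally have "(\<lambda>n. measure M (\<Union>k. A k) - measure M (\<Union>k<n. A k)) \<longlonglongrightarrow>
      measure M (\<Union>k. A k) - measure M (\<Union>k. A k)"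
    by (intro tendsto_intros)
  then show ?thesis by simp
qed

private lemma approximable_UN:
  fixes A :: "nat \<Rightarrow> ('i \<Rightarrow> real) set"
  assumes A: "\<And>k. A k \<in> sets B" and ap: "\<And>k. approximable I P Q (A k)"
  shows "approximable I P Q (\<Union>k. A k)"
  unfolding approximable_def
proof (intro allI impI)
  fix \<epsilon> :: real assume \<epsilon>: "\<epsilon> > 0"
  have "\<forall>\<^sub>F n in sequentially. measure P (\<Union>k. A k) - measure P (\<Union>k<n. A k) < \<epsilon> / 2"
    "\<forall>\<^sub>F n in sequentially. measure Q (\<Union>k. A k) - measure Q (\<Union>k<n. A k) < \<epsilon> / 2"
    using order_tendstoD(2)[OF measure_UN_lessThan_tendsto[OF P sets_P A], of "\<epsilon> / 2"]
      order_tendstoD(2)[OF measure_UN_lessThan_tendsto[OF Q sets_Q A], of "\<epsilon> / 2"] \<epsilon> by auto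
  then have "\<forall>\<^sub>F n in sequentially. measure P (\<Union>k. A k) - measure P (\<Union>k<n. A k) < \<epsilon> / 2 \<and>
    measure Q (\<Union>k. A k) - measure Q (\<Union>k<n. A k) < \<epsilon> / 2" by (rule eventually_conj)
  then obtain n where n: "measure P (\<Union>k. A k) - measure P (\<Union>k<n. A k) < \<epsilon> / 2"
    "measure Q (\<Union>k. A k) - measure Q (\<Union>k<n. A k) < \<epsilon> / 2"
    using eventually_happens'[OF sequentially_bot] by blast
  \<comment> \<open>The accuracy is chosen after \<open>n\<close>, since \<open>n\<close> errors are
    added. The summand 1 keeps the denominator positive when \<open>n = 0\<close>.\<close>
  define e where "e = \<epsilon> / (2 * (real n + 1))"
  have e: "e > 0" "real n * e \<le> \<epsilon> / 2" using \<epsilon> by (auto simp: e_def field_simps)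
  have "\<forall>k. \<exists>F. cylinder_continuous I F \<and>
     (\<integral>y. \<bar>indicator (A k) y - F y\<bar> \<partial>P) < e \<and> (\<integral>y. \<bar>indicator (A k) y - F y\<bar> \<partial>Q) < e"
    using ap e(1) unfolding approximable_def by blast
  then obtain F where F: "\<And>k. cylinder_continuous I (F k)"
    "\<And>k. (\<integral>y. \<bar>indicator (A k) y - F k y\<bar> \<partial>P) < e" "\<And>k. (\<integral>y. \<bar>indicator (A k) y - F k y\<bar> \<partial>Q) < e"
    by metis
  show "\<exists>F. cylinder_continuous I F \<and> (\<integral>y. \<bar>indicator (\<Union>k. A k) y - F y\<bar> \<partial>P) < \<epsilon> \<and>
      (\<integral>y. \<bar>indicator (\<Union>k. A k) y - F y\<bar> \<partial>Q) < \<epsilon>"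
  proof (intro exI conjI)
    show "cylinder_continuous I (\<lambda>y. 1 - (\<Prod>k<n. 1 - F k y))"
      by (intro cylinder_continuous_compl cylinder_continuous_prod F)
    show "(\<integral>y. \<bar>indicator (\<Union>k. A k) y - (1 - (\<Prod>k<n. 1 - F k y))\<bar> \<partial>P) < \<epsilon>"
      using approx_UN_bound[where A = A and F = F and n = n and \<epsilon> = e,
          OF P sets_P A F(1) less_imp_le[OF F(2)]] n(1) e(2) by linarith
    show "(\<integral>y. \<bar>indicator (\<Union>k. A k) y - (1 - (\<Prod>k<n. 1 - F k y))\<bar> \<partial>Q) < \<epsilon>"
      using approx_UN_bound[where A = A and F = F and n = n and \<epsilon> = e,
          OF Q sets_Q A F(1) less_imp_le[OF F(3)]] n(2) e(2) by linarith
  qed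
qed

private lemma approximable_compl:
  assumes "approximable I P Q E"
  shows "approximable I P Q (space B - E)"
proof -
  have eq: "(\<integral>y. \<bar>indicator (space B - E) y - (1 - F y)\<bar> \<partial>M) = (\<integral>y. \<bar>indicator E y - F y\<bar> \<partial>M)"
    if "sets M = sets B" for M and F :: "_ \<Rightarrow> real"
    using sets_eq_imp_space_eq[OF that]
    by (intro Bochner_Integration.integral_cong refl) (auto simp: indicator_def)
  show ?thesis
    unfolding approximable_def
  proof (intro allI impI)
    fix \<epsilon> :: real assume "\<epsilon> > 0"
    then obtain F where "cylinder_continuous I F" "(\<integral>y. \<bar>indicator E y - F y\<bar> \<partial>P) < \<epsilon>"
      "(\<integral>y. \<bar>indicator E y - F y\<bar> \<partial>Q) < \<epsilon>"
      using assms unfolding approximable_def by blast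
    then show "\<exists>F. cylinder_continuous I F \<and> (\<integral>y. \<bar>indicator (space B - E) y - F y\<bar> \<partial>P) < \<epsilon> \<and>
      (\<integral>y. \<bar>indicator (space B - E) y - F y\<bar> \<partial>Q) < \<epsilon>"
      by (intro exI[of _ "\<lambda>y. 1 - F y"]) (simp add: eq[OF sets_P] eq[OF sets_Q] cylinder_continuous_compl)
  qed
qed

text \<open>Piecewise linear, equal to 1 on \<open>{..u}\<close> and, for \<open>n > 0\<close>, to 0
  from \<open>u + 1 / n\<close> on. The limit is exactly the indicator of the closed half-line,
  whatever mass sits at \<open>u\<close>.\<close>

private definition "ramp u n x = max 0 (min 1 (1 - real n * (x - u)))" for u x :: real

private lemma ramp_tendsto: "(\<lambda>n. ramp u n x) \<longlonglongrightarrow> indicator {..u} x"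
proof (cases "x \<le> u")
  case True
  then have "ramp u n x = 1" for n
    by (simp add: ramp_def mult_nonneg_nonpos)
  then show ?thesis using True by simp
next
  case False
  then obtain n0 where n0: "1 / (x - u) < real n0" using reals_Archimedean2 by blast
  have "ramp u n x = 0" if "n \<ge> n0" for n
  proof -
    have "1 / (x - u) \<le> real n" using n0 that by linarith
    then have "1 \<le> real n * (x - u)" using False by (simp add: field_simps)
    then show ?thesis by (simp add: ramp_def)
  qed
  then have "\<forall>\<^sub>F n in sequentially. ramp u n x = 0" by (auto simp: eventually_sequentially)
  then show ?thesis using False by (simp add: tendsto_eventually)
qed

private lemma approximable_half_space:
  assumes c: "c \<in> I"
  shows "approximable I P Q {y \<in> space B. y c \<le> u}"
  unfolding approximable_def
proof (intro allI impI)
  fix \<epsilon> :: real assume \<epsilon>: "\<epsilon> > 0"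
  let ?E = "{y \<in> space B. y c \<le> u}"
  have E: "?E \<in> sets B" using c by measurable
  have ramp_cyl: "cylinder_continuous I (\<lambda>y. ramp u n (y c))" for n
    unfolding cylinder_continuous_def
  proof (intro conjI allI impI)
    show "(\<lambda>y. ramp u n (y c)) \<in> borel_measurable B" unfolding ramp_def using c by measurable
    show "(\<lambda>m. ramp u n (Y m c)) \<longlonglongrightarrow> ramp u n (y c)" if "\<forall>c\<in>I. (\<lambda>n. Y n c) \<longlonglongrightarrow> y c" for Y y
      unfolding ramp_def using that c by (intro tendsto_intros) auto
  qed (auto simp: ramp_def)
  have lim: "(\<lambda>n. \<integral>y. \<bar>indicator ?E y - ramp u n (y c)\<bar> \<partial>M) \<longlonglongrightarrow> 0"
    if M: "prob_space M" "sets M = sets B" for M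
  proof -
    interpret prob_space M by (rule M(1))
    have sp: "space M = space B" by (rule sets_eq_imp_space_eq[OF M(2)])
    have "(\<lambda>n. \<integral>y. \<bar>indicator ?E y - ramp u n (y c)\<bar> \<partial>M) \<longlonglongrightarrow> (\<integral>y. 0 \<partial>M)"
    proof (rule integral_dominated_convergence[where w = "\<lambda>_. 1"])
      show "AE y in M. (\<lambda>n. \<bar>indicator ?E y - ramp u n (y c)\<bar>) \<longlonglongrightarrow> 0"
      proof (intro AE_I2)
        fix y assume y: "y \<in> space M"
        have "(\<lambda>n. \<bar>indicator {..u} (y c) - ramp u n (y c)\<bar>) \<longlonglongrightarrow> \<bar>indicator {..u} (y c) - indicator {..u} (y c)\<bar>"
          by (intro tendsto_intros ramp_tendsto)
        then show "(\<lambda>n. \<bar>indicator ?E y - ramp u n (y c)\<bar>) \<longlonglongrightarrow> 0"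
          using y sp by (simp add: indicator_def)
      qed
      show "AE y in M. norm \<bar>indicator ?E y - ramp u n (y c)\<bar> \<le> 1" for n
        by (intro AE_I2) (auto simp: indicator_def ramp_def)
    qed (use integrable_approx[OF M E ramp_cyl] in \<open>auto dest: borel_measurable_integrable\<close>)
    then show ?thesis by simp
  qed
  have "\<forall>\<^sub>F n in sequentially. (\<integral>y. \<bar>indicator ?E y - ramp u n (y c)\<bar> \<partial>P) < \<epsilon> \<and>
      (\<integral>y. \<bar>indicator ?E y - ramp u n (y c)\<bar> \<partial>Q) < \<epsilon>"
    using order_tendstoD(2)[OF lim[OF P sets_P] \<epsilon>] order_tendstoD(2)[OF lim[OF Q sets_Q] \<epsilon>]
    by (rule eventually_conj)
  then obtain n where "(\<integral>y. \<bar>indicator ?E y - ramp u n (y c)\<bar> \<partial>P) < \<epsilon>"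
      "(\<integral>y. \<bar>indicator ?E y - ramp u n (y c)\<bar> \<partial>Q) < \<epsilon>"
    using eventually_happens'[OF sequentially_bot] by blast
  then show "\<exists>F. cylinder_continuous I F \<and> (\<integral>y. \<bar>indicator ?E y - F y\<bar> \<partial>P) < \<epsilon> \<and>
      (\<integral>y. \<bar>indicator ?E y - F y\<bar> \<partial>Q) < \<epsilon>" using ramp_cyl by blast
qed

text \<open>The approximable measurable sets form a sigma-algebra that contains the coordinate
  half-spaces. All coordinates are measurable for it, hence so is the identity into the product
  space, which says that every product-measurable set belongs to it.\<close>

lemma approximable_sets:
  assumes "E \<in> sets (PiM I (\<lambda>_. borel))"
  shows "approximable I P Q E"
proof -
  define \<A> where "\<A> = {E \<in> sets B. approximable I P Q E}"
  have "approximable I P Q {}"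
    unfolding approximable_def
    by (auto intro!: exI[of _ "\<lambda>_. 0"] cylinder_continuous_const)
  interpret A: sigma_algebra "space B" \<A>
    unfolding sigma_algebra_iff2
  proof (intro conjI ballI allI impI)
    show "\<A> \<subseteq> Pow (space B)" using sets.sets_into_space by (auto simp: \<A>_def)
    show "{} \<in> \<A>" using \<open>approximable I P Q {}\<close> by (simp add: \<A>_def)
    show "space B - s \<in> \<A>" if "s \<in> \<A>" for s
      using that by (auto simp: \<A>_def approximable_compl)
    fix A :: "nat \<Rightarrow> ('i \<Rightarrow> real) set" assume "range A \<subseteq> \<A>"
    then have "\<And>k. A k \<in> sets B" "\<And>k. approximable I P Q (A k)" by (auto simp: \<A>_def)
    then show "\<Union> (range A) \<in> \<A>" unfolding \<A>_def using approximable_UN by auto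
  qed
  define S where "S = sigma (space B) \<A>"
  have sS: "sets S = \<A>" "space S = space B"
    using A.sets_measure_of_eq A.space_measure_of_eq by (simp_all add: S_def)
  have comp: "(\<lambda>y. y c) \<in> borel_measurable S" if "c \<in> I" for c
  proof (subst borel_measurable_iff_le, intro allI)
    fix u
    have "{y \<in> space B. y c \<le> u} \<in> sets B" using that by measurable
    then show "{y \<in> space S. y c \<le> u} \<in> sets S"
      unfolding sS \<A>_def using approximable_half_space[OF that] by auto
  qed
  have "(\<lambda>y. y) \<in> S \<rightarrow>\<^sub>M B"
  proof (rule measurable_PiM_single)
    fix A c assume "c \<in> I" "A \<in> sets (borel :: real measure)"
    then show "{y \<in> space S. y c \<in> A} \<in> sets S"
      using measurable_sets[OF comp, of c A] by (simp add: vimage_def Int_def conj_commute)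
  qed (auto simp: sS space_PiM)
  from measurable_sets[OF this assms] have "E \<in> \<A>"
    using sets.sets_into_space[OF assms] by (simp add: sS Int_absorb2)
  then show ?thesis by (simp add: \<A>_def)
qed

end

text \<open>Replacing the indicator of \<open>E\<close> by a test function costs \<epsilon> under
  \<open>P\<close> and \<tau> times \<epsilon> under \<open>Q\<close>, whence the choice
  \<open>e / (1 + \<tau>)\<close>. In this form the inequality between two laws can be checked on
  quantities that pass to weak limits.\<close>

lemma measure_le_of_cylinder_integral_le:
  fixes P Q :: "('i \<Rightarrow> real) measure"
  assumes P: "prob_space P" and Q: "prob_space Q"
    and sets_P: "sets P = sets (PiM I (\<lambda>_. borel))" and sets_Q: "sets Q = sets (PiM I (\<lambda>_. borel))"
    and E: "E \<in> sets (PiM I (\<lambda>_. borel))" and \<tau>: "\<tau> \<ge> 0"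
    and le: "\<And>F. cylinder_continuous I F \<Longrightarrow> (\<integral>y. F y \<partial>P) \<le> \<tau> * (\<integral>y. F y \<partial>Q) + \<delta>"
  shows "measure P E \<le> \<tau> * measure Q E + \<delta>"
proof (rule field_le_epsilon)
  fix e :: real assume e: "e > 0"
  define \<epsilon> where "\<epsilon> = e / (1 + \<tau>)"
  have \<epsilon>: "\<epsilon> > 0" "\<epsilon> * (1 + \<tau>) = e" using e \<tau> by (auto simp: \<epsilon>_def)
  obtain F where F: "cylinder_continuous I F" "(\<integral>y. \<bar>indicator E y - F y\<bar> \<partial>P) < \<epsilon>"
      "(\<integral>y. \<bar>indicator E y - F y\<bar> \<partial>Q) < \<epsilon>"
    using approximable_sets[OF P Q sets_P sets_Q E] \<epsilon>(1) unfolding approximable_def by blast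
  have near: "\<bar>measure M E - (\<integral>y. F y \<partial>M)\<bar> \<le> (\<integral>y. \<bar>indicator E y - F y\<bar> \<partial>M)"
    if M: "prob_space M" "sets M = sets (PiM I (\<lambda>_. borel))" for M
  proof -
    interpret prob_space M by (rule M(1))
    have [measurable]: "F \<in> borel_measurable M"
      using cylinder_continuousD(1)[OF F(1)] by (simp add: measurable_cong_sets[OF M(2) refl])
    have [measurable]: "E \<in> sets M" using E M by simp
    have iF: "integrable M F"
      using cylinder_continuousD(2,3)[OF F(1)]
      by (intro integrable_const_bound[where B = 1]) auto
    have "measure M E - (\<integral>y. F y \<partial>M) = (\<integral>y. indicator E y - F y \<partial>M)"
      using iF integrable_real_indicator[OF \<open>E \<in> sets M\<close>]
      by (subst Bochner_Integration.integral_diff) (auto simp: emeasure_eq_measure)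
    also have "\<bar>\<dots>\<bar> \<le> (\<integral>y. \<bar>indicator E y - F y\<bar> \<partial>M)"
      by (rule integral_abs_bound)
    finally show ?thesis .
  qed
  have "\<tau> * (\<integral>y. F y \<partial>Q) \<le> \<tau> * (measure Q E + \<epsilon>)"
    using near[OF Q sets_Q] F(3) \<tau> by (intro mult_left_mono) auto
  then show "measure P E \<le> \<tau> * measure Q E + \<delta> + e"
    using near[OF P sets_P] F(2) le[OF F(1)] \<epsilon>(2) by (simp add: algebra_simps)
qed

section \<open>Riemann sums and Wiener increments\<close>

lemma floor_div_tendsto:
  fixes t :: real assumes "t \<ge> 0"
  shows "(\<lambda>n. real (nat \<lfloor>real (Suc n) * t\<rfloor>) / real (Suc n)) \<longlonglongrightarrow> t"
proof (rule tendsto_sandwich)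
  have fl: "real (nat \<lfloor>real (Suc n) * t\<rfloor>) = of_int \<lfloor>real (Suc n) * t\<rfloor>" for n
    using assms by simp
  show "\<forall>\<^sub>F n in sequentially. t - 1 / real (Suc n) \<le> real (nat \<lfloor>real (Suc n) * t\<rfloor>) / real (Suc n)"
  proof (intro always_eventually allI)
    fix n
    have "real (Suc n) * t - 1 \<le> of_int \<lfloor>real (Suc n) * t\<rfloor>" by linarith
    then have "(real (Suc n) * t - 1) / real (Suc n) \<le> of_int \<lfloor>real (Suc n) * t\<rfloor> / real (Suc n)"
      by (intro divide_right_mono) auto
    then show "t - 1 / real (Suc n) \<le> real (nat \<lfloor>real (Suc n) * t\<rfloor>) / real (Suc n)"
      unfolding fl by (simp add: diff_divide_distrib)
  qed
  show "\<forall>\<^sub>F n in sequentially. real (nat \<lfloor>real (Suc n) * t\<rfloor>) / real (Suc n) \<le> t"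
  proof (intro always_eventually allI)
    fix n
    have "of_int \<lfloor>real (Suc n) * t\<rfloor> \<le> real (Suc n) * t" by linarith
    then show "real (nat \<lfloor>real (Suc n) * t\<rfloor>) / real (Suc n) \<le> t"
      unfolding fl by (simp add: divide_le_eq mult.commute)
  qed
  show "(\<lambda>n. t - 1 / real (Suc n)) \<longlonglongrightarrow> t"
    using tendsto_diff[OF tendsto_const LIMSEQ_inverse_real_of_nat, of t] by (simp add: inverse_eq_divide)
qed simp

lemma floor_div_mem:
  fixes t :: real assumes "t \<in> {0..1}"
  shows "nat \<lfloor>real (Suc n) * t\<rfloor> \<le> Suc n" "real (nat \<lfloor>real (Suc n) * t\<rfloor>) / real (Suc n) \<in> {0..1}"
proof -
  have "real (Suc n) * t \<le> real (Suc n) * 1" using assms by (intro mult_left_mono) auto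
  then have "\<lfloor>real (Suc n) * t\<rfloor> \<le> \<lfloor>real (Suc n)\<rfloor>" by (intro floor_mono) (simp only: mult_1_right)
  also have "\<dots> = int (Suc n)" by (rule floor_of_nat)
  finally have "\<lfloor>real (Suc n) * t\<rfloor> \<le> int (Suc n)" .
  then show 1: "nat \<lfloor>real (Suc n) * t\<rfloor> \<le> Suc n" by linarith
  then have "real (nat \<lfloor>real (Suc n) * t\<rfloor>) \<le> real (Suc n)" by linarith
  then show "real (nat \<lfloor>real (Suc n) * t\<rfloor>) / real (Suc n) \<in> {0..1}" by (simp add: divide_le_eq)
qed

text \<open>Left-end sums up to \<open>t\<close> rounded down to the grid, the form in which the
  discretised drift appears. The primitive \<open>F\<close> telescopes over the cells, and uniform
  continuity of \<open>f\<close> bounds the error per cell; continuity of \<open>F\<close> removes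
  the rounding of \<open>t\<close>.\<close>

lemma riemann_sum_tendsto:
  fixes f :: "real \<Rightarrow> real"
  assumes f: "continuous_on {0..1} f" and t: "t \<in> {0..1}"
  shows "(\<lambda>n. (\<Sum>l<nat \<lfloor>real (Suc n) * t\<rfloor>. f (real l / real (Suc n))) / real (Suc n)) \<longlonglongrightarrow> integral {0..t} f"
proof -
  define m where "m = (\<lambda>n. nat \<lfloor>real (Suc n) * t\<rfloor>)"
  define F where "F = (\<lambda>x. integral {0..x} f)"
  have int: "f integrable_on {a..b}" if "0 \<le> a" "b \<le> 1" for a b
    by (rule integrable_continuous_interval, rule continuous_on_subset[OF f]) (use that in auto)
  have contF: "continuous_on {0..1} F"
    unfolding F_def by (rule indefinite_integral_continuous_1) (simp add: int)
  have mt: "m n \<le> Suc n" "real (m n) / real (Suc n) \<in> {0..1}" for n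
    unfolding m_def using floor_div_mem[OF t] by auto
  have "(\<lambda>n. F (real (m n) / real (Suc n))) \<longlonglongrightarrow> F t"
    by (rule continuous_on_tendsto_compose[OF contF])
       (use floor_div_tendsto[of t] t mt(2) in \<open>auto simp: m_def\<close>)
  moreover have "(\<lambda>n. (\<Sum>l<m n. f (real l / real (Suc n))) / real (Suc n) - F (real (m n) / real (Suc n))) \<longlonglongrightarrow> 0"
  proof (rule LIMSEQ_I)
    fix e :: real assume e: "e > 0"
    have "uniformly_continuous_on {0..1} f" by (rule compact_uniformly_continuous[OF f]) simp
    then obtain \<delta> where \<delta>: "\<delta> > 0"
      "\<And>x y. x \<in> {0..1} \<Longrightarrow> y \<in> {0..1} \<Longrightarrow> dist y x < \<delta> \<Longrightarrow> dist (f y) (f x) < e / 2"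
      using e unfolding uniformly_continuous_on_def by (meson half_gt_zero)
    obtain n0 where n0: "1 / \<delta> < real n0" using reals_Archimedean2 by blast
    show "\<exists>n0. \<forall>n\<ge>n0. norm ((\<Sum>l<m n. f (real l / real (Suc n))) / real (Suc n) - F (real (m n) / real (Suc n)) - 0) < e"
    proof (intro exI[of _ n0] allI impI)
      fix n assume n: "n \<ge> n0"
      define N where "N = real (Suc n)"
      have N: "N > 0" by (simp add: N_def)
      have "1 / \<delta> < N" using n0 n by (simp add: N_def)
      then have N\<delta>: "1 / N < \<delta>" using \<delta>(1) N by (simp add: field_simps)
      have step: "\<bar>F (real (Suc l) / N) - F (real l / N) - f (real l / N) / N\<bar> \<le> e / 2 / N" if l: "l < m n" for l
      proof -
        let ?a = "real l / N" and ?b = "real (Suc l) / N"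
        have "real (Suc l) \<le> N" using l mt(1)[of n] unfolding N_def by linarith
        then have ab: "0 \<le> ?a" "?a \<le> ?b" "?b \<le> 1" using N by (auto simp: divide_right_mono)
        have len: "?b - ?a = 1 / N" using N by (simp add: field_simps)
        have "F ?a + integral {?a..?b} f = F ?b"
          unfolding F_def using ab by (intro Henstock_Kurzweil_Integration.integral_combine int) auto
        moreover have "integral {?a..?b} (\<lambda>x. f x - f ?a) = integral {?a..?b} f - f ?a / N"
        proof -
          have "integral {?a..?b} (\<lambda>x. f x - f ?a) = integral {?a..?b} f - integral {?a..?b} (\<lambda>x. f ?a)"
            using ab by (intro Henstock_Kurzweil_Integration.integral_diff int) auto
          also have "integral {?a..?b} (\<lambda>x. f ?a) = f ?a / N"
            using ab len by simp
          finally show ?thesis .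
        qed
        moreover have "norm (integral {?a..?b} (\<lambda>x. f x - f ?a)) \<le> e / 2 * (?b - ?a)"
        proof (rule integral_bound)
          show "continuous_on {?a..?b} (\<lambda>x. f x - f ?a)"
            using ab by (intro continuous_intros continuous_on_subset[OF f]) auto
          show "norm (f x - f ?a) \<le> e / 2" if "x \<in> {?a..?b}" for x
          proof -
            have "dist x ?a < \<delta>" using that N\<delta> len by (auto simp: dist_real_def)
            then have "dist (f x) (f ?a) < e / 2" using that ab by (intro \<delta>(2)) auto
            then show ?thesis by (simp add: dist_norm)
          qed
        qed (use ab in auto)
        ultimately show ?thesis unfolding len by simp
      qed
      have "F (real (m n) / N) - (\<Sum>l<m n. f (real l / N)) / N =
          (\<Sum>l<m n. F (real (Suc l) / N) - F (real l / N) - f (real l / N) / N)"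
      proof -
        have "(\<Sum>l<m n. F (real (Suc l) / N) - F (real l / N)) = F (real (m n) / N)"
          using sum_lessThan_telescope[of "\<lambda>l. F (real l / N)" "m n"] by (simp add: F_def)
        then show ?thesis by (simp add: sum_subtractf sum_divide_distrib)
      qed
      also have "\<bar>\<dots>\<bar> \<le> (\<Sum>l<m n. \<bar>F (real (Suc l) / N) - F (real l / N) - f (real l / N) / N\<bar>)"
        by (rule sum_abs)
      also have "\<dots> \<le> real (m n) * (e / 2 / N)"
      proof -
        have "(\<Sum>l<m n. \<bar>F (real (Suc l) / N) - F (real l / N) - f (real l / N) / N\<bar>) \<le>
            of_nat (card {..<m n}) * (e / 2 / N)"
          by (rule sum_bounded_above, rule step) simp
        then show ?thesis by (simp only: card_lessThan)
      qed
      also have "\<dots> = real (m n) / N * (e / 2)" by simp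
      also have "\<dots> \<le> 1 * (e / 2)"
        using mt(2)[of n] e unfolding N_def by (intro mult_right_mono) auto
      finally show "norm ((\<Sum>l<m n. f (real l / real (Suc n))) / real (Suc n) - F (real (m n) / real (Suc n)) - 0) < e"
        using e unfolding N_def by (simp add: abs_minus_commute)
    qed
  qed
  ultimately have "(\<lambda>n. (\<Sum>l<m n. f (real l / real (Suc n))) / real (Suc n)) \<longlonglongrightarrow> F t"
    by (rule Lim_transform)
  then show ?thesis by (simp add: m_def F_def)
qed

section \<open>Joint independence and Gaussian law of the Wiener increments\<close>

text \<open>The whole sigma-algebras serve as generators. As the full space is one of the admissible
  sets, the product rule over all of \<open>I\<close> already contains the rules for
  subfamilies.\<close>

lemma (in prob_space) indep_vars_finite_iff:
  assumes "I \<noteq> {}" "finite I" "\<And>i. i \<in> I \<Longrightarrow> random_variable (M' i) (X i)"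
  shows "indep_vars M' X I \<longleftrightarrow>
    (\<forall>A\<in>(\<Pi> i\<in>I. sets (M' i)). prob (\<Inter>j\<in>I. X j -` A j \<inter> space M) = (\<Prod>j\<in>I. prob (X j -` A j \<inter> space M)))"
  using assms
  by (intro indep_vars_finite)
     (auto simp: sets.sigma_sets_eq Int_stable_def sets.space_closed dest: sets.sets_into_space)

text \<open>For fixed \<open>i\<close>, the conditions on all \<open>f i j (X i)\<close> amount to
  one event \<open>C i\<close> for \<open>X i\<close>. Independence of the \<open>X i\<close>
  factorises over \<open>i\<close>, and the inner independence then factorises each factor over
  \<open>j\<close>.\<close>

lemma (in prob_space) indep_vars_nested:
  assumes I: "I \<noteq> {}" "finite I" and J: "J \<noteq> {}" "finite J"
    and X: "indep_vars S X I"
    and f: "\<And>i j. i \<in> I \<Longrightarrow> j \<in> J \<Longrightarrow> f i j \<in> S i \<rightarrow>\<^sub>M N i j"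
    and inner: "\<And>i. i \<in> I \<Longrightarrow> indep_vars (N i) (\<lambda>j \<omega>. f i j (X i \<omega>)) J"
  shows "indep_vars (\<lambda>(i, j). N i j) (\<lambda>(i, j) \<omega>. f i j (X i \<omega>)) (I \<times> J)"
proof -
  have rvX: "random_variable (S i) (X i)" if "i \<in> I" for i
    using X that by (auto simp: indep_vars_def)
  have rv: "random_variable (N i j) (\<lambda>\<omega>. f i j (X i \<omega>))" if "i \<in> I" "j \<in> J" for i j
    using measurable_compose[OF rvX f] that by auto
  show ?thesis
  proof (subst indep_vars_finite_iff)
    show "\<forall>A\<in>(\<Pi> k\<in>I \<times> J. sets (case k of (i, j) \<Rightarrow> N i j)).
      prob (\<Inter>k\<in>I \<times> J. (case k of (i, j) \<Rightarrow> \<lambda>\<omega>. f i j (X i \<omega>)) -` A k \<inter> space M) =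
      (\<Prod>k\<in>I \<times> J. prob ((case k of (i, j) \<Rightarrow> \<lambda>\<omega>. f i j (X i \<omega>)) -` A k \<inter> space M))"
    proof
      fix A assume "A \<in> (\<Pi> k\<in>I \<times> J. sets (case k of (i, j) \<Rightarrow> N i j))"
      then have A: "A (i, j) \<in> sets (N i j)" if "i \<in> I" "j \<in> J" for i j
        using that by (auto dest!: Pi_mem[where x = "(i, j)"])
      define C where "C i = (\<Inter>j\<in>J. f i j -` A (i, j) \<inter> space (S i))" for i
      have C: "C i \<in> sets (S i)" if "i \<in> I" for i
        unfolding C_def using J that by (intro sets.finite_INT measurable_sets[OF f] A) auto
      have Xsp: "X i \<omega> \<in> space (S i)" if "i \<in> I" "\<omega> \<in> space M" for i \<omega>
        using measurable_space[OF rvX] that by auto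
      have XC: "X i -` C i \<inter> space M = (\<Inter>j\<in>J. (\<lambda>\<omega>. f i j (X i \<omega>)) -` A (i, j) \<inter> space M)" if "i \<in> I" for i
        unfolding C_def using Xsp[OF that] J by auto
      have "(\<Inter>k\<in>I \<times> J. (case k of (i, j) \<Rightarrow> \<lambda>\<omega>. f i j (X i \<omega>)) -` A k \<inter> space M) =
          (\<Inter>i\<in>I. X i -` C i \<inter> space M)"
        using I J by (simp add: XC) auto
      also have "prob \<dots> = (\<Prod>i\<in>I. prob (X i -` C i \<inter> space M))"
        using X C I by (subst (asm) indep_vars_finite_iff) (auto intro: rvX)
      also have "\<dots> = (\<Prod>i\<in>I. \<Prod>j\<in>J. prob ((\<lambda>\<omega>. f i j (X i \<omega>)) -` A (i, j) \<inter> space M))"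
      proof (intro prod.cong refl)
        fix i assume i: "i \<in> I"
        have "\<forall>A\<in>(\<Pi> j\<in>J. sets (N i j)). prob (\<Inter>j\<in>J. (\<lambda>\<omega>. f i j (X i \<omega>)) -` A j \<inter> space M) =
            (\<Prod>j\<in>J. prob ((\<lambda>\<omega>. f i j (X i \<omega>)) -` A j \<inter> space M))"
          using inner[OF i] J rv[OF i] by (subst (asm) indep_vars_finite_iff) auto
        from bspec[OF this, of "\<lambda>j. A (i, j)"]
        show "prob (X i -` C i \<inter> space M) = (\<Prod>j\<in>J. prob ((\<lambda>\<omega>. f i j (X i \<omega>)) -` A (i, j) \<inter> space M))"
          using A i by (auto simp: XC)
      qed
      also have "\<dots> = (\<Prod>k\<in>I \<times> J. prob ((case k of (i, j) \<Rightarrow> \<lambda>\<omega>. f i j (X i \<omega>)) -` A k \<inter> space M))"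
        by (simp add: prod.cartesian_product case_prod_beta)
      finally show "prob (\<Inter>k\<in>I \<times> J. (case k of (i, j) \<Rightarrow> \<lambda>\<omega>. f i j (X i \<omega>)) -` A k \<inter> space M) =
        (\<Prod>k\<in>I \<times> J. prob ((case k of (i, j) \<Rightarrow> \<lambda>\<omega>. f i j (X i \<omega>)) -` A k \<inter> space M))" .
    qed
  qed (use I J rv in auto)
qed

text \<open>Independence is given on three levels: time increments of a coordinate, coordinates of a
  process, and processes. Two applications of \<open>indep_vars_nested\<close> merge them into one
  finite family.\<close>

lemma wiener_increments_indep:
  assumes M: "prob_space M" and w: "independent_wieners M N d 1 w" and pos: "N \<ge> 1" "d \<ge> 1"
  shows "prob_space.indep_vars M (\<lambda>_. borel)
     (\<lambda>(i, j, l) \<omega>. w i j (real (Suc l) / real (Suc n)) \<omega> - w i j (real l / real (Suc n)) \<omega>)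
     ({..<N} \<times> {..<d} \<times> {..<Suc n})"
proof -
  interpret prob_space M by fact
  let ?W = "PiM {0..1} (\<lambda>_. borel) :: (real \<Rightarrow> real) measure"
  let ?V = "PiM ({..<d} \<times> {0..1}) (\<lambda>_. borel) :: (nat \<times> real \<Rightarrow> real) measure"
  let ?t = "\<lambda>l. real l / real (Suc n)"
  have t01: "?t l \<in> {0..1}" if "l \<le> Suc n" for l using that by simp
  have sw: "standard_wiener M d 1 (w i)" if "i < N" for i
    using w that by (simp add: independent_wieners_def)
  have l1: "indep_vars (\<lambda>_. borel) (\<lambda>l \<omega>. w i j (?t (Suc l)) \<omega> - w i j (?t l) \<omega>) {..<Suc n}"
    if "i < N" "j < d" for i j
  proof -
    have "standard_wiener_1d M 1 (w i j)" using sw[OF that(1)] that(2) by (simp add: standard_wiener_def)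
    moreover have "strict_mono_on {..Suc n} ?t" by (auto simp: strict_mono_on_def divide_strict_right_mono)
    moreover have "?t ` {..Suc n} \<subseteq> {0..1}" using t01 by auto
    ultimately show ?thesis unfolding standard_wiener_1d_def by blast
  qed
  have l2: "indep_vars (\<lambda>_. borel) (\<lambda>(j, l) \<omega>. w i j (?t (Suc l)) \<omega> - w i j (?t l) \<omega>) ({..<d} \<times> {..<Suc n})"
    if i: "i < N" for i
  proof -
    have "indep_vars (\<lambda>(j, l). borel) (\<lambda>(j, l) \<omega>. (\<lambda>x. x (?t (Suc l)) - x (?t l)) (\<lambda>t\<in>{0..1}. w i j t \<omega>))
        ({..<d} \<times> {..<Suc n})"
    proof (rule indep_vars_nested[where S = "\<lambda>_. ?W" and N = "\<lambda>_ _. borel"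
          and f = "\<lambda>_ l x. x (?t (Suc l)) - x (?t l)" and X = "\<lambda>j \<omega>. \<lambda>t\<in>{0..1}. w i j t \<omega>"])
      show "indep_vars (\<lambda>_. ?W) (\<lambda>j \<omega>. \<lambda>t\<in>{0..1}. w i j t \<omega>) {..<d}"
        using sw[OF i] by (simp add: standard_wiener_def)
      show "(\<lambda>x. x (?t (Suc l)) - x (?t l)) \<in> borel_measurable ?W" if "l \<in> {..<Suc n}" for l
        using that t01[of l] t01[of "Suc l"]
        by (intro borel_measurable_diff measurable_component_singleton) auto
      show "indep_vars (\<lambda>_. borel) (\<lambda>l \<omega>. (\<lambda>t\<in>{0..1}. w i j t \<omega>) (?t (Suc l)) - (\<lambda>t\<in>{0..1}. w i j t \<omega>) (?t l)) {..<Suc n}"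
        if "j \<in> {..<d}" for j
        using l1[OF i, of j] that t01 by (subst indep_vars_cong[OF refl _ refl]) auto
    qed (use pos in \<open>auto simp: lessThan_empty_iff\<close>)
    also have "?this \<longleftrightarrow> ?thesis"
      by (intro indep_vars_cong refl) (use t01 in \<open>auto simp: case_prod_beta\<close>)
    finally show ?thesis .
  qed
  have "indep_vars (\<lambda>(i, k). borel)
      (\<lambda>(i, k) \<omega>. (case k of (j, l) \<Rightarrow> \<lambda>x. x (j, ?t (Suc l)) - x (j, ?t l)) (\<lambda>(j, t)\<in>{..<d} \<times> {0..1}. w i j t \<omega>))
      ({..<N} \<times> ({..<d} \<times> {..<Suc n}))"
  proof (rule indep_vars_nested[where S = "\<lambda>_. ?V" and N = "\<lambda>_ _. borel"
        and f = "\<lambda>_ k. case k of (j, l) \<Rightarrow> \<lambda>x. x (j, ?t (Suc l)) - x (j, ?t l)"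
        and X = "\<lambda>i \<omega>. \<lambda>(j, t)\<in>{..<d} \<times> {0..1}. w i j t \<omega>"])
    show "indep_vars (\<lambda>_. ?V) (\<lambda>i \<omega>. \<lambda>(j, t)\<in>{..<d} \<times> {0..1}. w i j t \<omega>) {..<N}"
      using w by (simp add: independent_wieners_def)
    show "(case k of (j, l) \<Rightarrow> \<lambda>x. x (j, ?t (Suc l)) - x (j, ?t l)) \<in> borel_measurable ?V"
      if "k \<in> {..<d} \<times> {..<Suc n}" for k
      using that t01 by (auto intro!: borel_measurable_diff measurable_component_singleton)
    show "indep_vars (\<lambda>_. borel) (\<lambda>k \<omega>. (case k of (j, l) \<Rightarrow> \<lambda>x. x (j, ?t (Suc l)) - x (j, ?t l))
        (\<lambda>(j, t)\<in>{..<d} \<times> {0..1}. w i j t \<omega>)) ({..<d} \<times> {..<Suc n})" if "i \<in> {..<N}" for i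
      using l2[of i] that t01 by (subst indep_vars_cong[OF refl _ refl]) (auto simp: case_prod_beta)
  qed (use pos in \<open>auto simp: lessThan_empty_iff\<close>)
  also have "?this \<longleftrightarrow> ?thesis"
    by (intro indep_vars_cong refl) (use t01 in \<open>auto simp: case_prod_beta\<close>)
  finally show ?thesis .
qed

text \<open>Whatever space carries the Wiener processes, their grid increments have the same product
  Gaussian law. This lets hypotheses that live on different probability spaces be compared on a
  single one.\<close>

lemma wiener_increments_distr:
  fixes w :: "nat \<Rightarrow> nat \<Rightarrow> real \<Rightarrow> 'a \<Rightarrow> real" and n :: nat
  assumes M: "prob_space M" and w: "independent_wieners M N d 1 w" and pos: "N \<ge> 1" "d \<ge> 1"
  defines "G \<equiv> {..<N} \<times> {..<d} \<times> {..<Suc n}"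
  defines "inc \<equiv> (\<lambda>(i, j, l) \<omega>. w i j (real (Suc l) / real (Suc n)) \<omega> - w i j (real l / real (Suc n)) \<omega>)"
  shows "(\<lambda>\<omega>. \<lambda>c\<in>G. inc c \<omega>) \<in> M \<rightarrow>\<^sub>M PiM G (\<lambda>_. gaussian (1 / sqrt (Suc n)))" (is ?A)
    and "distr M (PiM G (\<lambda>_. gaussian (1 / sqrt (Suc n)))) (\<lambda>\<omega>. \<lambda>c\<in>G. inc c \<omega>) =
      PiM G (\<lambda>_. gaussian (1 / sqrt (Suc n)))" (is ?B)
proof -
  interpret prob_space M by fact
  let ?\<gamma> = "gaussian (1 / sqrt (Suc n))"
  have law: "distributed M lborel (inc c) (normal_density 0 (1 / sqrt (Suc n)))" if c_in: "c \<in> G" for c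
  proof -
    obtain i j l where c: "c = (i, j, l)" "i < N" "j < d" "l < Suc n" using c_in by (auto simp: G_def)
    let ?s = "real l / real (Suc n)" and ?t = "real (Suc l) / real (Suc n)"
    have "standard_wiener_1d M 1 (w i j)"
      using w c by (simp add: independent_wieners_def standard_wiener_def)
    moreover have "0 \<le> ?s" "?s < ?t" "?t \<le> 1" using c(4) by (auto simp: divide_strict_right_mono)
    ultimately have "distributed M lborel (\<lambda>\<omega>. w i j ?t \<omega> - w i j ?s \<omega>) (normal_density 0 (sqrt (?t - ?s)))"
      unfolding standard_wiener_1d_def by blast
    moreover have "?t - ?s = 1 / real (Suc n)" by (simp add: field_simps)
    moreover have "sqrt (1 / real (Suc n)) = 1 / sqrt (Suc n)" by (simp only: real_sqrt_divide real_sqrt_one)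
    ultimately show ?thesis by (simp only: inc_def c prod.case)
  qed
  have rv: "random_variable borel (inc c)" if "c \<in> G" for c
    using distributed_measurable[OF law[OF that]] by simp
  show ?A by (intro measurable_restrict) (simp add: rv measurable_cong_sets[OF refl sets_gaussian])
  have d: "distr M borel (inc c) = ?\<gamma>" if "c \<in> G" for c
  proof -
    have "distr M borel (inc c) = distr M lborel (inc c)" by (rule distr_cong) auto
    then show ?thesis using distributed_distr_eq_density[OF law[OF that]] by (simp add: gaussian_def)
  qed
  have "G \<noteq> {}" using pos by (auto simp: G_def lessThan_empty_iff)
  then have "distr M (PiM G (\<lambda>_. borel)) (\<lambda>\<omega>. \<lambda>c\<in>G. inc c \<omega>) = PiM G (\<lambda>c. distr M borel (inc c))"
    using indep_vars_iff_distr_eq_PiM'[where I = G and M' = "\<lambda>_. borel" and X = inc] rv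
      wiener_increments_indep[OF M w pos, of n, folded G_def inc_def] by blast
  also have "\<dots> = PiM G (\<lambda>_. ?\<gamma>)" by (intro PiM_cong refl d)
  also have "distr M (PiM G (\<lambda>_. borel)) (\<lambda>\<omega>. \<lambda>c\<in>G. inc c \<omega>) = distr M (PiM G (\<lambda>_. ?\<gamma>)) (\<lambda>\<omega>. \<lambda>c\<in>G. inc c \<omega>)"
    by (intro distr_cong refl sets_PiM_cong) simp
  finally show ?B .
qed

text \<open>The difference with \<open>w 0\<close> is taken because \<open>w 0\<close> vanishes only
  almost surely. Time 0 is separate: the increments have a normal density only over intervals of
  positive length.\<close>

lemma wiener_second_moment:
  assumes M: "prob_space M" and w: "standard_wiener_1d M 1 w" and t: "t \<in> {0..1}"
  shows "(\<integral>\<^sup>+\<omega>. ennreal ((w t \<omega> - w 0 \<omega>)\<^sup>2) \<partial>M) = ennreal t"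
proof (cases "t = 0")
  case False
  then have t0: "t > 0" "t \<le> 1" using t by auto
  then have D: "distributed M lborel (\<lambda>\<omega>. w t \<omega> - w 0 \<omega>) (normal_density 0 (sqrt t))"
    using w unfolding standard_wiener_1d_def by force
  have "(\<integral>\<^sup>+\<omega>. ennreal ((w t \<omega> - w 0 \<omega>)\<^sup>2) \<partial>M) = (\<integral>\<^sup>+x. normal_density 0 (sqrt t) x * ennreal (x\<^sup>2) \<partial>lborel)"
    using distributed_nn_integral[OF D, of "\<lambda>x. ennreal (x\<^sup>2)"] by simp
  also have "\<dots> = (\<integral>\<^sup>+x. ennreal (normal_density 0 (sqrt t) x * x\<^sup>2) \<partial>lborel)"
    by (simp add: ennreal_mult)
  also have "\<dots> = ennreal t"
  proof -
    have "has_bochner_integral lborel (\<lambda>x. normal_density 0 (sqrt t) x * x\<^sup>2) t"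
      using normal_moment_even[of "sqrt t" 0 1] t0 by (simp add: fact_numeral)
    then show ?thesis
      by (subst nn_integral_eq_integral) (auto simp: has_bochner_integral_iff)
  qed
  finally show ?thesis .
qed simp

section \<open>Change of a single drift coefficient\<close>

text \<open>The constant sequence \<open>restrict y I\<close> converges to \<open>y\<close> in every
  coordinate of \<open>I\<close>, and limits are unique.\<close>

lemma cylinder_continuous_restrict:
  assumes "cylinder_continuous I F"
  shows "F (restrict y I) = F y"
proof -
  have "(\<lambda>n::nat. F (restrict y I)) \<longlonglongrightarrow> F y"
    by (rule cylinder_continuousD(4)[OF assms]) auto
  then show ?thesis by (simp add: LIMSEQ_const_iff)
qed

abbreviation obs_index :: "nat \<Rightarrow> nat \<Rightarrow> (nat \<times> nat \<times> real) set" where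
  "obs_index N d \<equiv> {..<N} \<times> {..<d} \<times> {0..1}"

abbreviation grid :: "nat \<Rightarrow> nat \<Rightarrow> nat \<Rightarrow> (nat \<times> nat \<times> nat) set" where
  "grid N d n \<equiv> {..<N} \<times> {..<d} \<times> {..<Suc n}"

abbreviation noise :: "nat \<Rightarrow> nat \<Rightarrow> nat \<Rightarrow> (nat \<times> nat \<times> nat \<Rightarrow> real) measure" where
  "noise N d n \<equiv> PiM (grid N d n) (\<lambda>_. gaussian (1 / sqrt (Suc n)))"

text \<open>The first Picard iterate of the equation, driven by the increments \<open>z\<close> of the noise on the
  grid of mesh \<open>1 / Suc n\<close>.  It is exact up to discretisation when \<open>A\<close> has square zero.\<close>

definition euler :: "nat \<Rightarrow> nat \<Rightarrow> real mat \<Rightarrow> (nat \<times> nat \<times> nat \<Rightarrow> real) \<Rightarrow> nat \<times> nat \<times> real \<Rightarrow> real" where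
  "euler d n A z = (\<lambda>(i, j, t).
     (\<Sum>l<nat \<lfloor>real (Suc n) * t\<rfloor>. z (i, j, l)) +
     (\<Sum>k<d. A $$ (j, k) * ((\<Sum>l<nat \<lfloor>real (Suc n) * t\<rfloor>. \<Sum>l'<l. z (i, k, l')) / real (Suc n))))"

text \<open>The condition forces square zero: a coordinate that drives another one has index at
  least \<open>h\<close> and thus has no drift of its own.\<close>

definition block_upper :: "nat \<Rightarrow> nat \<Rightarrow> real mat \<Rightarrow> bool" where
  "block_upper h d A \<longleftrightarrow> (\<forall>j<d. \<forall>k<d. A $$ (j, k) \<noteq> 0 \<longrightarrow> j < h \<and> h \<le> k)"

lemma euler_measurable:
  assumes F: "cylinder_continuous (obs_index N d) F"
  shows "(\<lambda>z. F (euler d n A z)) \<in> borel_measurable (noise N d n)"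
proof -
  have "(\<lambda>z. \<lambda>c\<in>obs_index N d. euler d n A z c) \<in> noise N d n \<rightarrow>\<^sub>M PiM (obs_index N d) (\<lambda>_. borel)"
  proof (intro measurable_restrict)
    fix c assume c_in: "c \<in> obs_index N d"
    obtain i j t where c: "c = (i, j, t)" "i < N" "j < d" "t \<in> {0..1}" using c_in by auto
    have m: "nat \<lfloor>real (Suc n) * t\<rfloor> \<le> Suc n" by (rule floor_div_mem(1)[OF c(4)])
    have z: "(\<lambda>z. z (i, k, l)) \<in> borel_measurable (noise N d n)" if "k < d" "l < Suc n" for k l
    proof -
      have "(\<lambda>z. z (i, k, l)) \<in> noise N d n \<rightarrow>\<^sub>M gaussian (1 / sqrt (Suc n))"
        by (rule measurable_component_singleton) (use that c(2) in auto)
      then show ?thesis by (simp only: measurable_cong_sets[OF refl sets_gaussian])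
    qed
    show "(\<lambda>z. euler d n A z c) \<in> borel_measurable (noise N d n)"
      unfolding euler_def c(1) prod.case
      using m c(3) by (intro borel_measurable_add borel_measurable_sum borel_measurable_times
          borel_measurable_const borel_measurable_divide z) auto
  qed
  from measurable_compose[OF this cylinder_continuousD(1)[OF F]]
  show ?thesis by (simp only: restrict_UNIV cylinder_continuous_restrict[OF F])
qed

text \<open>The scheme is run on the space of \<open>P\<close> with the increments of the Wiener
  processes that drive the solution. There it converges almost surely, coordinate by coordinate, to
  the observed path, and dominated convergence applies. The left side depends only on the law of the
  increments, so it can be stated on the common noise space.\<close>

lemma ou_law_euler_tendsto:
  assumes P: "ou_law N d 1 (\<lambda>i. 0\<^sub>v d) A P" and A: "block_upper h d A"
    and pos: "N \<ge> 1" "d \<ge> 1" and F: "cylinder_continuous (obs_index N d) F"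
  shows "(\<lambda>n. \<integral>z. F (euler d n A z) \<partial>noise N d n) \<longlonglongrightarrow> (\<integral>y. F y \<partial>P)"
proof -
  from P obtain w where w: "independent_wieners P N d 1 w"
    and sol: "ou_solution P N d 1 (\<lambda>i. 0\<^sub>v d) A w (\<lambda>i j t y. y (i, j, t))"
    and prob: "prob_space P" and sets: "sets P = sets (obs_space N d 1)"
    unfolding ou_law_def by blast
  interpret prob_space P by fact
  define inc where "inc n = (\<lambda>(i, j, l) \<omega>. w i j (real (Suc l) / real (Suc n)) \<omega> - w i j (real l / real (Suc n)) \<omega>)" for n
  define Z where "Z n = (\<lambda>\<omega>. \<lambda>c\<in>grid N d n. inc n c \<omega>)" for n
  have Z: "Z n \<in> P \<rightarrow>\<^sub>M noise N d n" and distr_Z: "distr P (noise N d n) (Z n) = noise N d n" for n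
    using wiener_increments_distr[OF prob w pos, of n] unfolding Z_def inc_def by auto
  have int_eq: "(\<integral>z. F (euler d n A z) \<partial>noise N d n) = (\<integral>\<omega>. F (euler d n A (Z n \<omega>)) \<partial>P)" for n
    using integral_distr[OF Z euler_measurable[OF F], of n A] by (simp only: distr_Z)
  have w1: "standard_wiener_1d P 1 (w i j)" if "i < N" "j < d" for i j
    using w that by (simp add: independent_wieners_def standard_wiener_def)
  have "AE \<omega> in P. \<forall>i\<in>{..<N}. \<forall>j\<in>{..<d}. w i j 0 \<omega> = 0 \<and> continuous_on {0..1} (\<lambda>t. w i j t \<omega>) \<and>
      (\<forall>t\<in>{0..1}. \<omega> (i, j, t) = integral {0..t} (\<lambda>u. \<Sum>k<d. A $$ (j, k) * \<omega> (i, k, u)) + w i j t \<omega>)"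
  proof (intro AE_finite_allI finite_lessThan)
    fix i j assume ij: "i \<in> {..<N}" "j \<in> {..<d}"
    have "AE \<omega> in P. \<forall>t\<in>{0..1}. \<omega> (i, j, t) = integral {0..t} (\<lambda>u. \<Sum>k<d. A $$ (j, k) * \<omega> (i, k, u)) + w i j t \<omega>"
      using sol ij unfolding ou_solution_def by simp
    moreover have "AE \<omega> in P. w i j 0 \<omega> = 0" "AE \<omega> in P. continuous_on {0..1} (\<lambda>t. w i j t \<omega>)"
      using w1[of i j] ij unfolding standard_wiener_1d_def by auto
    ultimately show "AE \<omega> in P. w i j 0 \<omega> = 0 \<and> continuous_on {0..1} (\<lambda>t. w i j t \<omega>) \<and>
      (\<forall>t\<in>{0..1}. \<omega> (i, j, t) = integral {0..t} (\<lambda>u. \<Sum>k<d. A $$ (j, k) * \<omega> (i, k, u)) + w i j t \<omega>)"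
      by eventually_elim auto
  qed
  then have lim: "AE \<omega> in P. (\<lambda>n. F (euler d n A (Z n \<omega>))) \<longlonglongrightarrow> F \<omega>"
  proof eventually_elim
    case (elim \<omega>)
    have w0: "w i j 0 \<omega> = 0" and cw: "continuous_on {0..1} (\<lambda>t. w i j t \<omega>)"
      and eq: "\<And>t. t \<in> {0..1} \<Longrightarrow>
        \<omega> (i, j, t) = integral {0..t} (\<lambda>u. \<Sum>k<d. A $$ (j, k) * \<omega> (i, k, u)) + w i j t \<omega>"
      if "i < N" "j < d" for i j
      using elim that by auto
    show ?case
    proof (rule cylinder_continuousD(4)[OF F])
      fix c assume c_in: "c \<in> obs_index N d"
      obtain i j t where c: "c = (i, j, t)" "i < N" "j < d" "t \<in> {0..1}" using c_in by auto
      have iw: "(\<lambda>u. w i k u \<omega>) integrable_on {0..t}" if "k < d" for k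
        by (rule integrable_continuous_interval, rule continuous_on_subset[OF cw[OF c(2) that]]) (use c(4) in auto)
      \<comment> \<open>The rows of \<open>A\<close> from \<open>h\<close> on are zero, so these
        coordinates of the path coincide with the driving noise. Only such coordinates occur under
        the drift integral, which closes the recursion.\<close>
      have low: "\<omega> (i, k, u) = w i k u \<omega>" if "k < d" "h \<le> k" "u \<in> {0..1}" for k u
      proof -
        have "A $$ (k, k') = 0" if "k' < d" for k'
          using A \<open>k < d\<close> \<open>h \<le> k\<close> that unfolding block_upper_def by (meson not_le)
        then show ?thesis using eq[OF c(2) that(1,3)] by simp
      qed
      have "\<omega> (i, j, t) = integral {0..t} (\<lambda>u. \<Sum>k<d. A $$ (j, k) * w i k u \<omega>) + w i j t \<omega>"
      proof -
        have "integral {0..t} (\<lambda>u. \<Sum>k<d. A $$ (j, k) * \<omega> (i, k, u)) =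
            integral {0..t} (\<lambda>u. \<Sum>k<d. A $$ (j, k) * w i k u \<omega>)"
        proof (intro Henstock_Kurzweil_Integration.integral_cong sum.cong refl)
          fix u k assume u: "u \<in> {0..t}" and k: "k \<in> {..<d}"
          show "A $$ (j, k) * \<omega> (i, k, u) = A $$ (j, k) * w i k u \<omega>"
          proof (cases "A $$ (j, k) = 0")
            case False
            then have "h \<le> k" using A c(3) k unfolding block_upper_def by auto
            then show ?thesis using low[of k u] u k c(4) by simp
          qed simp
        qed
        then show ?thesis using eq[OF c(2,3,4)] by simp
      qed
      also have "integral {0..t} (\<lambda>u. \<Sum>k<d. A $$ (j, k) * w i k u \<omega>) =
          (\<Sum>k<d. A $$ (j, k) * integral {0..t} (\<lambda>u. w i k u \<omega>))"
        using iw by (subst Henstock_Kurzweil_Integration.integral_sum)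
          (auto intro!: integrable_on_mult_right simp: integral_mult_right)
      finally have target: "\<omega> c = w i j t \<omega> + (\<Sum>k<d. A $$ (j, k) * integral {0..t} (\<lambda>u. w i k u \<omega>))"
        by (simp add: c(1))
      have tel: "(\<Sum>l<m. Z n \<omega> (i, k, l)) = w i k (real m / real (Suc n)) \<omega>" if "k < d" "m \<le> Suc n" for k m n
      proof -
        have "(\<Sum>l<m. Z n \<omega> (i, k, l)) =
            (\<Sum>l<m. w i k (real (Suc l) / real (Suc n)) \<omega> - w i k (real l / real (Suc n)) \<omega>)"
          using that c(2) by (intro sum.cong refl) (auto simp: Z_def inc_def)
        also have "\<dots> = w i k (real m / real (Suc n)) \<omega> - w i k (real 0 / real (Suc n)) \<omega>"
          by (rule sum_lessThan_telescope)
        finally show ?thesis using w0[OF c(2) that(1)] by simp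
      qed
      have "euler d n A (Z n \<omega>) c = w i j (real (nat \<lfloor>real (Suc n) * t\<rfloor>) / real (Suc n)) \<omega> +
          (\<Sum>k<d. A $$ (j, k) * ((\<Sum>l<nat \<lfloor>real (Suc n) * t\<rfloor>. w i k (real l / real (Suc n)) \<omega>) / real (Suc n)))" for n
      proof -
        have m: "nat \<lfloor>real (Suc n) * t\<rfloor> \<le> Suc n" by (rule floor_div_mem(1)[OF c(4)])
        show ?thesis
          unfolding euler_def c(1) prod.case using m
          by (intro arg_cong2[where f = "(+)"] sum.cong refl arg_cong2[where f = "(*)"]
              arg_cong2[where f = "(/)"] tel c(3)) auto
      qed
      moreover have "(\<lambda>n. w i j (real (nat \<lfloor>real (Suc n) * t\<rfloor>) / real (Suc n)) \<omega>) \<longlonglongrightarrow> w i j t \<omega>"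
        by (rule continuous_on_tendsto_compose[OF cw[OF c(2,3)] floor_div_tendsto])
           (use c(4) floor_div_mem(2)[OF c(4)] in auto)
      moreover have "(\<lambda>n. (\<Sum>l<nat \<lfloor>real (Suc n) * t\<rfloor>. w i k (real l / real (Suc n)) \<omega>) / real (Suc n))
          \<longlonglongrightarrow> integral {0..t} (\<lambda>u. w i k u \<omega>)" if "k < d" for k
        by (rule riemann_sum_tendsto[OF cw[OF c(2) that] c(4)])
      ultimately show "(\<lambda>n. euler d n A (Z n \<omega>) c) \<longlonglongrightarrow> \<omega> c"
        unfolding target by (auto intro!: tendsto_add tendsto_sum tendsto_mult tendsto_const
            simp only: lessThan_iff)
    qed
  qed
  have FP: "F \<in> borel_measurable P"
  proof -
    have "F \<in> borel_measurable (obs_space N d 1)"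
      unfolding obs_space_def by (rule measurable_restrict_space1[OF cylinder_continuousD(1)[OF F]])
    then show ?thesis by (simp add: measurable_cong_sets[OF sets refl])
  qed
  have "(\<lambda>n. \<integral>\<omega>. F (euler d n A (Z n \<omega>)) \<partial>P) \<longlonglongrightarrow> (\<integral>\<omega>. F \<omega> \<partial>P)"
  proof (rule integral_dominated_convergence[where w = "\<lambda>_. 1"])
    show "(\<lambda>\<omega>. F (euler d n A (Z n \<omega>))) \<in> borel_measurable P" for n
      by (rule measurable_compose[OF Z euler_measurable[OF F]])
    show "AE \<omega> in P. norm (F (euler d n A (Z n \<omega>))) \<le> 1" for n
      using cylinder_continuousD(2,3)[OF F] by auto
  qed (use lim FP in auto)
  then show ?thesis by (simp only: int_eq)
qed

text \<open>Read off from the Wiener processes behind \<open>P\<close>: their increments have the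
  law \<open>noise\<close>, the partial sum telescopes to the increment from 0 to
  \<open>l / Suc n\<close>, and its second moment is the length of this interval.\<close>

lemma noise_second_moment:
  assumes P: "ou_law N d 1 \<xi> A P" and pos: "N \<ge> 1" "d \<ge> 1" and "i < N" "k < d" "l \<le> Suc n"
  shows "(\<integral>\<^sup>+z. ennreal ((\<Sum>l'<l. z (i, k, l'))\<^sup>2) \<partial>noise N d n) \<le> 1"
proof -
  from P obtain w where w: "independent_wieners P N d 1 w" and prob: "prob_space P"
    unfolding ou_law_def by blast
  define inc where "inc = (\<lambda>(i, j, l) \<omega>. w i j (real (Suc l) / real (Suc n)) \<omega> - w i j (real l / real (Suc n)) \<omega>)"
  define Z where "Z = (\<lambda>\<omega>. \<lambda>c\<in>grid N d n. inc c \<omega>)"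
  have Z: "Z \<in> P \<rightarrow>\<^sub>M noise N d n" and distr_Z: "distr P (noise N d n) Z = noise N d n"
    using wiener_increments_distr[OF prob w pos, of n] unfolding Z_def inc_def by auto
  have w1: "standard_wiener_1d P 1 (w i k)"
    using w assms by (simp add: independent_wieners_def standard_wiener_def)
  have z: "(\<lambda>z. z (i, k, l')) \<in> borel_measurable (noise N d n)" if "l' < l" for l'
  proof -
    have "(\<lambda>z. z (i, k, l')) \<in> noise N d n \<rightarrow>\<^sub>M gaussian (1 / sqrt (Suc n))"
      by (rule measurable_component_singleton) (use that assms in auto)
    then show ?thesis by (simp only: measurable_cong_sets[OF refl sets_gaussian])
  qed
  have tel: "(\<Sum>l'<l. Z \<omega> (i, k, l')) = w i k (real l / real (Suc n)) \<omega> - w i k 0 \<omega>" for \<omega>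
  proof -
    have "(\<Sum>l'<l. Z \<omega> (i, k, l')) =
        (\<Sum>l'<l. w i k (real (Suc l') / real (Suc n)) \<omega> - w i k (real l' / real (Suc n)) \<omega>)"
      using assms by (intro sum.cong refl) (auto simp: Z_def inc_def)
    also have "\<dots> = w i k (real l / real (Suc n)) \<omega> - w i k (real 0 / real (Suc n)) \<omega>"
      by (rule sum_lessThan_telescope)
    finally show ?thesis by simp
  qed
  have "(\<integral>\<^sup>+z. ennreal ((\<Sum>l'<l. z (i, k, l'))\<^sup>2) \<partial>noise N d n) =
      (\<integral>\<^sup>+z. ennreal ((\<Sum>l'<l. z (i, k, l'))\<^sup>2) \<partial>distr P (noise N d n) Z)"
    by (simp only: distr_Z)
  also have "\<dots> = (\<integral>\<^sup>+\<omega>. ennreal ((w i k (real l / real (Suc n)) \<omega> - w i k 0 \<omega>)\<^sup>2) \<partial>P)"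
    using z by (subst nn_integral_distr[OF Z])
      (auto simp: tel intro!: measurable_compose[OF _ measurable_ennreal] borel_measurable_power borel_measurable_sum)
  also have "\<dots> = ennreal (real l / real (Suc n))"
    using assms by (intro wiener_second_moment[OF prob w1]) auto
  also have "\<dots> \<le> ennreal 1"
    using assms by (intro ennreal_leI) (auto simp: divide_le_eq)
  finally show ?thesis by simp
qed

text \<open>An extra drift \<open>a\<close> times coordinate \<open>k0\<close> in row
  \<open>j0\<close> acts exactly like adding \<open>a / Suc n\<close> times the current value of
  that coordinate to each noise increment of row \<open>j0\<close>. The change of drift thereby
  becomes a translation of the noise, without discretisation error.\<close>

lemma euler_perturbation:
  fixes z :: "nat \<times> nat \<times> nat \<Rightarrow> real" and a :: real
  assumes A0: "block_upper h d A0" and j0: "j0 < h" and k0: "k0 < d"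
    and A1: "\<And>j k. j < d \<Longrightarrow> k < d \<Longrightarrow> A1 $$ (j, k) = A0 $$ (j, k) + (if j = j0 \<and> k = k0 then a else 0)"
    and c_in: "c \<in> obs_index N d"
  shows "euler d n A1 z c = euler d n A0 (\<lambda>c\<in>grid N d n. z c +
    (if fst (snd c) = j0 then a * ((\<Sum>l'<snd (snd c). z (fst c, k0, l')) / real (Suc n)) else 0)) c"
    (is "_ = euler d n A0 ?z c")
proof -
  obtain i j t where c: "c = (i, j, t)" "i < N" "j < d" "t \<in> {0..1}" using c_in by auto
  define m where "m = nat \<lfloor>real (Suc n) * t\<rfloor>"
  have m: "m \<le> Suc n" unfolding m_def by (rule floor_div_mem(1)[OF c(4)])
  have z1: "(\<Sum>l<m. ?z (i, j, l)) = (\<Sum>l<m. z (i, j, l)) +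
      (if j = j0 then a * ((\<Sum>l<m. \<Sum>l'<l. z (i, k0, l')) / real (Suc n)) else 0)"
  proof -
    have "(\<Sum>l<m. ?z (i, j, l)) = (\<Sum>l<m. z (i, j, l) + (if j = j0 then a * ((\<Sum>l'<l. z (i, k0, l')) / real (Suc n)) else 0))"
      using c m by (intro sum.cong refl) auto
    then show ?thesis by (simp add: sum.distrib sum_distrib_left sum_divide_distrib)
  qed
  \<comment> \<open>The shifted row is not fed back into the drift: column \<open>j0\<close> of
    \<open>A0\<close> is zero, because \<open>j0 < h\<close>.\<close>
  have z2: "A0 $$ (j, k) * ((\<Sum>l<m. \<Sum>l'<l. ?z (i, k, l')) / real (Suc n)) =
      A0 $$ (j, k) * ((\<Sum>l<m. \<Sum>l'<l. z (i, k, l')) / real (Suc n))" if "k < d" for k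
  proof (cases "A0 $$ (j, k) = 0")
    case False
    then have "k \<noteq> j0" using A0 j0 c(3) that unfolding block_upper_def by fastforce
    then have "?z (i, k, l') = z (i, k, l')" if "l' < Suc n" for l'
      using c(2) \<open>k < d\<close> that by auto
    then have "(\<Sum>l<m. \<Sum>l'<l. ?z (i, k, l')) = (\<Sum>l<m. \<Sum>l'<l. z (i, k, l'))"
      using m by (intro sum.cong refl) auto
    then show ?thesis by simp
  qed simp
  have "(\<Sum>k<d. A1 $$ (j, k) * ((\<Sum>l<m. \<Sum>l'<l. z (i, k, l')) / real (Suc n))) =
      (\<Sum>k<d. A0 $$ (j, k) * ((\<Sum>l<m. \<Sum>l'<l. z (i, k, l')) / real (Suc n)) +
        (if k = k0 then (if j = j0 then a * ((\<Sum>l<m. \<Sum>l'<l. z (i, k0, l')) / real (Suc n)) else 0) else 0))"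
    by (intro sum.cong refl) (use c(3) in \<open>auto simp: A1 distrib_right add_divide_distrib simp del: of_nat_Suc\<close>)
  also have "\<dots> = (\<Sum>k<d. A0 $$ (j, k) * ((\<Sum>l<m. \<Sum>l'<l. z (i, k, l')) / real (Suc n))) +
      (if j = j0 then a * ((\<Sum>l<m. \<Sum>l'<l. z (i, k0, l')) / real (Suc n)) else 0)"
    using k0 by (simp add: sum.distrib sum.delta)
  finally have e1: "euler d n A1 z c = (\<Sum>l<m. z (i, j, l)) +
      ((\<Sum>k<d. A0 $$ (j, k) * ((\<Sum>l<m. \<Sum>l'<l. z (i, k, l')) / real (Suc n))) +
      (if j = j0 then a * ((\<Sum>l<m. \<Sum>l'<l. z (i, k0, l')) / real (Suc n)) else 0))"
    unfolding euler_def c(1) prod.case m_def by simp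
  have "(\<Sum>k<d. A0 $$ (j, k) * ((\<Sum>l<m. \<Sum>l'<l. ?z (i, k, l')) / real (Suc n))) =
      (\<Sum>k<d. A0 $$ (j, k) * ((\<Sum>l<m. \<Sum>l'<l. z (i, k, l')) / real (Suc n)))"
    by (intro sum.cong refl z2) simp
  then have e0: "euler d n A0 ?z c = (\<Sum>l<m. ?z (i, j, l)) +
      (\<Sum>k<d. A0 $$ (j, k) * ((\<Sum>l<m. \<Sum>l'<l. z (i, k, l')) / real (Suc n)))"
    unfolding euler_def c(1) prod.case m_def by simp
  show ?thesis unfolding e1 e0 z1 by simp
qed

text \<open>The grid splits into the increments \<open>J\<close> of row \<open>j0\<close>, which are
  shifted, and the others \<open>R\<close>, which determine the shift;
  \<open>j0 < h \<le> k0\<close> ensures that row \<open>k0\<close> lies in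
  \<open>R\<close>.\<close>

lemma euler_integral_le:
  assumes P0: "ou_law N d 1 \<xi> A0 P0" and pos: "N \<ge> 1"
    and A0: "block_upper h d A0" and j0: "j0 < h" and k0: "h \<le> k0" "k0 < d"
    and A1: "\<And>j k. j < d \<Longrightarrow> k < d \<Longrightarrow> A1 $$ (j, k) = A0 $$ (j, k) + (if j = j0 \<and> k = k0 then a else 0)"
    and F: "cylinder_continuous (obs_index N d) F" and t: "t > 0"
  shows "(\<integral>z. F (euler d n A1 z) \<partial>noise N d n) \<le>
    exp t * (\<integral>z. F (euler d n A0 z) \<partial>noise N d n) + (2 / t + 4 / t\<^sup>2) * (a\<^sup>2 * real N)"
proof -
  let ?\<sigma> = "1 / sqrt (real (Suc n))" and ?n = "real (Suc n)"
  have \<sigma>: "?\<sigma> > 0" "?\<sigma>\<^sup>2 = 1 / ?n" by (auto simp: power_divide)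
  define R where "R = {..<N} \<times> ({..<d} - {j0}) \<times> {..<Suc n}"
  define J where "J = {..<N} \<times> {j0} \<times> {..<Suc n}"
  have RJ: "R \<union> J = grid N d n" "R \<inter> J = {}" "finite R" "finite J"
    using j0 k0 by (auto simp: R_def J_def)
  define S where "S = (\<lambda>(i :: nat, j :: nat, l :: nat) z. a * ((\<Sum>l'<l. z (i, k0, l')) / ?n))"
  interpret prob_space "noise N d n" by (intro prob_space_PiM prob_space_gaussian \<sigma>)
  have int: "(\<integral>\<^sup>+z. ennreal (F (euler d n A z)) \<partial>noise N d n) = ennreal (\<integral>z. F (euler d n A z) \<partial>noise N d n)" for A
    using cylinder_continuousD(2,3)[OF F] euler_measurable[OF F]
    by (intro nn_integral_eq_integral integrable_const_bound[where B = 1]) auto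
  have int0: "(\<integral>z. F (euler d n A z) \<partial>noise N d n) \<ge> 0" for A
    using cylinder_continuousD(2)[OF F] by (intro Bochner_Integration.integral_nonneg) auto
  \<comment> \<open>There are \<open>N * Suc n\<close> shifted cells, each with mean square at most
    \<open>a\<^sup>2 / (Suc n)\<^sup>2\<close>. Division by the cell variance
    \<open>1 / Suc n\<close> will leave \<open>a\<^sup>2 * N\<close>, independently of the mesh, so
    the bound survives refinement.\<close>
  have SJ: "(\<integral>\<^sup>+z. ennreal (\<Sum>c\<in>J. (S c z)\<^sup>2) \<partial>noise N d n) \<le> ennreal (a\<^sup>2 * real N / ?n)"
  proof -
    have Sm: "S c \<in> borel_measurable (noise N d n)" if c_in: "c \<in> J" for c
    proof -
      obtain i l where c: "c = (i, j0, l)" "i < N" "l < Suc n" using c_in by (auto simp: J_def)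
      have "(\<lambda>z. z (i, k0, l')) \<in> borel_measurable (noise N d n)" if "l' < l" for l'
        using measurable_component_singleton[of "(i, k0, l')" "grid N d n" "\<lambda>_. gaussian ?\<sigma>"] that c k0
        by (simp add: measurable_cong_sets[OF refl sets_gaussian])
      then show ?thesis
        unfolding S_def c(1) prod.case
        by (intro borel_measurable_times borel_measurable_const borel_measurable_divide borel_measurable_sum) auto
    qed
    have "(\<integral>\<^sup>+z. ennreal (\<Sum>c\<in>J. (S c z)\<^sup>2) \<partial>noise N d n) = (\<integral>\<^sup>+z. (\<Sum>c\<in>J. ennreal ((S c z)\<^sup>2)) \<partial>noise N d n)"
      by (simp add: sum_ennreal)
    also have "\<dots> = (\<Sum>c\<in>J. \<integral>\<^sup>+z. ennreal ((S c z)\<^sup>2) \<partial>noise N d n)"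
      using Sm by (intro nn_integral_sum measurable_compose[OF _ measurable_ennreal] borel_measurable_power)
    also have "\<dots> \<le> (\<Sum>c\<in>J. ennreal (a\<^sup>2 / ?n\<^sup>2))"
    proof (intro sum_mono)
      fix c assume c_in: "c \<in> J"
      obtain i l where c: "c = (i, j0, l)" "i < N" "l < Suc n" using c_in by (auto simp: J_def)
      have d1: "d \<ge> 1" using k0 by auto
      have z: "(\<lambda>z. z (i, k0, l')) \<in> borel_measurable (noise N d n)" if "l' < l" for l'
        using measurable_component_singleton[of "(i, k0, l')" "grid N d n" "\<lambda>_. gaussian ?\<sigma>"] that c k0
        by (simp add: measurable_cong_sets[OF refl sets_gaussian])
      have "(\<integral>\<^sup>+z. ennreal ((S c z)\<^sup>2) \<partial>noise N d n) =
          (\<integral>\<^sup>+z. ennreal (a\<^sup>2 / ?n\<^sup>2) * ennreal ((\<Sum>l'<l. z (i, k0, l'))\<^sup>2) \<partial>noise N d n)"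
        by (intro nn_integral_cong)
           (simp add: S_def c(1) ennreal_mult[symmetric] power_mult_distrib power_divide)
      also have "\<dots> = ennreal (a\<^sup>2 / ?n\<^sup>2) * (\<integral>\<^sup>+z. ennreal ((\<Sum>l'<l. z (i, k0, l'))\<^sup>2) \<partial>noise N d n)"
        using z by (intro nn_integral_cmult measurable_compose[OF _ measurable_ennreal]
            borel_measurable_power borel_measurable_sum) auto
      also have "\<dots> \<le> ennreal (a\<^sup>2 / ?n\<^sup>2) * 1"
        using c k0 by (intro mult_left_mono noise_second_moment[OF P0 pos d1]) auto
      finally show "(\<integral>\<^sup>+z. ennreal ((S c z)\<^sup>2) \<partial>noise N d n) \<le> ennreal (a\<^sup>2 / ?n\<^sup>2)" by simp
    qed
    also have "\<dots> = ennreal (\<Sum>c\<in>J. a\<^sup>2 / ?n\<^sup>2)" by (rule sum_ennreal) simp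
    also have "(\<Sum>c\<in>J. a\<^sup>2 / ?n\<^sup>2) = a\<^sup>2 * real N / ?n"
    proof -
      have "real (card J) = real N * ?n"
        by (simp only: J_def card_cartesian_product card_lessThan card.empty card.insert of_nat_mult) simp
      then show ?thesis by (simp add: power2_eq_square del: of_nat_Suc)
    qed
    finally show ?thesis .
  qed
  have "ennreal (\<integral>z. F (euler d n A1 z) \<partial>noise N d n) = (\<integral>\<^sup>+z. ennreal (F (euler d n A1 z)) \<partial>noise N d n)"
    by (simp only: int)
  also have "\<dots> = (\<integral>\<^sup>+z. ennreal (F (euler d n A0 (\<lambda>c\<in>grid N d n. z c + (if c \<in> J then S c z else 0)))) \<partial>noise N d n)"
  proof (intro nn_integral_cong arg_cong[where f = ennreal])
    fix z
    have eq: "(\<lambda>c\<in>grid N d n. z c + (if c \<in> J then S c z else 0)) = (\<lambda>c\<in>grid N d n. z c +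
      (if fst (snd c) = j0 then a * ((\<Sum>l'<snd (snd c). z (fst c, k0, l')) / ?n) else 0))"
      by (intro restrict_ext) (auto simp: J_def S_def)
    have "restrict (euler d n A1 z) (obs_index N d) =
        restrict (euler d n A0 (\<lambda>c\<in>grid N d n. z c + (if c \<in> J then S c z else 0))) (obs_index N d)"
      unfolding eq by (rule restrict_ext, rule euler_perturbation[OF A0 j0 k0(2) A1])
    from arg_cong[OF this, of F]
    show "F (euler d n A1 z) = F (euler d n A0 (\<lambda>c\<in>grid N d n. z c + (if c \<in> J then S c z else 0)))"
      by (simp only: cylinder_continuous_restrict[OF F])
  qed
  also have "\<dots> \<le> ennreal (exp t) * (\<integral>\<^sup>+z. ennreal (F (euler d n A0 z)) \<partial>noise N d n) +
      ennreal ((2 / t + 4 / t\<^sup>2) / ?\<sigma>\<^sup>2) * (\<integral>\<^sup>+z. ennreal (\<Sum>c\<in>J. (S c z)\<^sup>2) \<partial>noise N d n)"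
  proof (rule gaussian_random_shift_le[OF \<sigma>(1) RJ(3,4,2) t, unfolded RJ(1)])
    show "(\<lambda>z. ennreal (F (euler d n A0 z))) \<in> borel_measurable (noise N d n)"
      by (rule measurable_compose[OF euler_measurable[OF F] measurable_ennreal])
    show "ennreal (F (euler d n A0 z)) \<le> 1" for z
      using cylinder_continuousD(3)[OF F] by simp
    fix c assume c_in: "c \<in> J"
    obtain i l where c: "c = (i, j0, l)" "i < N" "l < Suc n" using c_in by (auto simp: J_def)
    have mem: "(i, k0, l') \<in> R" if "l' < l" for l'
      using that c j0 k0 by (auto simp: R_def)
    have "(\<lambda>z. z (i, k0, l')) \<in> borel_measurable (PiM R (\<lambda>_. gaussian ?\<sigma>))" if "l' < l" for l'
      using measurable_component_singleton[OF mem[OF that], of "\<lambda>_. gaussian ?\<sigma>"]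
      by (simp only: measurable_cong_sets[OF refl sets_gaussian])
    then show "S c \<in> borel_measurable (PiM R (\<lambda>_. gaussian ?\<sigma>))"
      unfolding S_def c(1) prod.case
      by (intro borel_measurable_times borel_measurable_const borel_measurable_divide borel_measurable_sum) auto
    show "S c z = S c (restrict z R)" for z
      unfolding S_def c(1) prod.case using mem by (auto intro!: sum.cong)
  qed
  also have "\<dots> \<le> ennreal (exp t) * (\<integral>\<^sup>+z. ennreal (F (euler d n A0 z)) \<partial>noise N d n) +
      ennreal ((2 / t + 4 / t\<^sup>2) / ?\<sigma>\<^sup>2) * ennreal (a\<^sup>2 * real N / ?n)"
    by (intro add_left_mono mult_left_mono SJ) simp
  also have "ennreal (exp t) * (\<integral>\<^sup>+z. ennreal (F (euler d n A0 z)) \<partial>noise N d n) +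
      ennreal ((2 / t + 4 / t\<^sup>2) / ?\<sigma>\<^sup>2) * ennreal (a\<^sup>2 * real N / ?n) =
      ennreal (exp t * (\<integral>z. F (euler d n A0 z) \<partial>noise N d n) + (2 / t + 4 / t\<^sup>2) * (a\<^sup>2 * real N))"
  proof -
    have "(2 / t + 4 / t\<^sup>2) / ?\<sigma>\<^sup>2 * (a\<^sup>2 * real N / ?n) = (2 / t + 4 / t\<^sup>2) * (a\<^sup>2 * real N)"
      unfolding \<sigma>(2) by (simp del: of_nat_Suc)
    moreover have "(2 / t + 4 / t\<^sup>2) / ?\<sigma>\<^sup>2 \<ge> 0" "(2 / t + 4 / t\<^sup>2) * (a\<^sup>2 * real N) \<ge> 0" using t by auto
    ultimately show ?thesis
      using int0[of A0] unfolding int by (simp add: ennreal_mult[symmetric] ennreal_plus del: of_nat_Suc)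
  qed
  finally show ?thesis
    using int0[of A0] t by (subst (asm) ennreal_le_iff) auto
qed

text \<open>The mesh tends to 0 for each test function separately; the resulting inequality between
  integrals is then extended to events. The two laws need not have been constructed on a common
  space.\<close>

lemma ou_law_measure_le:
  assumes P0: "ou_law N d 1 (\<lambda>i. 0\<^sub>v d) A0 P0" and P1: "ou_law N d 1 (\<lambda>i. 0\<^sub>v d) A1 P1"
    and pos: "N \<ge> 1" and A0: "block_upper h d A0" and j0: "j0 < h" and k0: "h \<le> k0" "k0 < d"
    and A1: "\<And>j k. j < d \<Longrightarrow> k < d \<Longrightarrow> A1 $$ (j, k) = A0 $$ (j, k) + (if j = j0 \<and> k = k0 then a else 0)"
    and t: "t > 0" and E: "E \<in> sets (obs_space N d 1)"
  shows "measure P1 E \<le> exp t * measure P0 E + (2 / t + 4 / t\<^sup>2) * (a\<^sup>2 * real N)"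
proof -
  let ?B = "PiM (obs_index N d) (\<lambda>_. borel) :: (nat \<times> nat \<times> real \<Rightarrow> real) measure"
  let ?C = "{y :: nat \<times> nat \<times> real \<Rightarrow> real. \<forall>i<N. \<forall>j<d. continuous_on {0..1} (\<lambda>t. y (i, j, t))}"
  have d1: "d \<ge> 1" using k0 by auto
  have A1': "block_upper h d A1"
    using A0 j0 k0 unfolding block_upper_def by (auto simp: A1 split: if_splits)
  have prob: "prob_space P0" "prob_space P1" and sets: "sets P0 = sets (obs_space N d 1)" "sets P1 = sets (obs_space N d 1)"
    using P0 P1 unfolding ou_law_def by auto
  have id: "(\<lambda>y. y) \<in> obs_space N d 1 \<rightarrow>\<^sub>M ?B"
    unfolding obs_space_def by (rule measurable_restrict_space1) simp
  have id': "(\<lambda>y. y) \<in> P0 \<rightarrow>\<^sub>M ?B" "(\<lambda>y. y) \<in> P1 \<rightarrow>\<^sub>M ?B"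
    using id by (simp_all add: measurable_cong_sets[OF sets(1) refl] measurable_cong_sets[OF sets(2) refl])
  \<comment> \<open>The set \<open>?C\<close> of continuous paths need not be product-measurable
    when time is uncountable. Events of the path space are therefore written as traces of product
    events, and both laws are pushed forward along the inclusion.\<close>
  from E obtain E' where E': "E' \<in> sets ?B" "E = ?C \<inter> E'"
    unfolding obs_space_def sets_restrict_space by auto
  have sp: "space P0 = ?C \<inter> space ?B" "space P1 = ?C \<inter> space ?B"
    using sets[THEN sets_eq_imp_space_eq] by (auto simp: obs_space_def space_restrict_space)
  have meas: "measure (distr P0 ?B (\<lambda>y. y)) E' = measure P0 E" "measure (distr P1 ?B (\<lambda>y. y)) E' = measure P1 E"
  proof -
    have "(\<lambda>y. y) -` E' \<inter> space P0 = E" "(\<lambda>y. y) -` E' \<inter> space P1 = E"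
      using sets.sets_into_space[OF E'(1)] unfolding E'(2) sp by blast+
    then show "measure (distr P0 ?B (\<lambda>y. y)) E' = measure P0 E" "measure (distr P1 ?B (\<lambda>y. y)) E' = measure P1 E"
      by (simp_all only: measure_distr[OF id'(1) E'(1)] measure_distr[OF id'(2) E'(1)])
  qed
  have "measure (distr P1 ?B (\<lambda>y. y)) E' \<le> exp t * measure (distr P0 ?B (\<lambda>y. y)) E' + (2 / t + 4 / t\<^sup>2) * (a\<^sup>2 * real N)"
  proof (rule measure_le_of_cylinder_integral_le[where I = "obs_index N d"])
    fix F assume F: "cylinder_continuous (obs_index N d) F"
    have "(\<integral>y. F y \<partial>P1) \<le> exp t * (\<integral>y. F y \<partial>P0) + (2 / t + 4 / t\<^sup>2) * (a\<^sup>2 * real N)"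
    proof (rule LIMSEQ_le)
      show "(\<lambda>n. \<integral>z. F (euler d n A1 z) \<partial>noise N d n) \<longlonglongrightarrow> (\<integral>y. F y \<partial>P1)"
        by (rule ou_law_euler_tendsto[OF P1 A1' pos d1 F])
      show "(\<lambda>n. exp t * (\<integral>z. F (euler d n A0 z) \<partial>noise N d n) + (2 / t + 4 / t\<^sup>2) * (a\<^sup>2 * real N)) \<longlonglongrightarrow>
          exp t * (\<integral>y. F y \<partial>P0) + (2 / t + 4 / t\<^sup>2) * (a\<^sup>2 * real N)"
        by (intro tendsto_intros ou_law_euler_tendsto[OF P0 A0 pos d1 F])
      show "\<exists>n0. \<forall>n\<ge>n0. (\<integral>z. F (euler d n A1 z) \<partial>noise N d n) \<le>
          exp t * (\<integral>z. F (euler d n A0 z) \<partial>noise N d n) + (2 / t + 4 / t\<^sup>2) * (a\<^sup>2 * real N)"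
        using euler_integral_le[OF P0 pos A0 j0 k0 A1 F t] by blast
    qed
    then show "(\<integral>y. F y \<partial>distr P1 ?B (\<lambda>y. y)) \<le> exp t * (\<integral>y. F y \<partial>distr P0 ?B (\<lambda>y. y)) + (2 / t + 4 / t\<^sup>2) * (a\<^sup>2 * real N)"
      by (simp add: integral_distr[OF id'(1) cylinder_continuousD(1)[OF F]]
          integral_distr[OF id'(2) cylinder_continuousD(1)[OF F]])
  qed (use E' prob in \<open>auto intro!: prob_space.prob_space_distr id'\<close>)
  then show ?thesis by (simp add: meas)
qed

section \<open>Sparse hypotheses\<close>

text \<open>Exchanging the stored value \<open>\<pi> \<beta>\<close> with the fresh value
  \<open>q\<close> is an involution on the pairs, so resampling one coordinate preserves the uniform
  average.\<close>

lemma sum_PiE_update: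
  fixes f :: "('b \<Rightarrow> nat) \<Rightarrow> real" and m :: nat
  assumes \<beta>: "\<beta> \<in> B" and B: "finite B"
  shows "(\<Sum>\<pi>\<in>PiE B (\<lambda>_. {..<m}). \<Sum>q<m. f (\<pi>(\<beta> := q))) = real m * (\<Sum>\<pi>\<in>PiE B (\<lambda>_. {..<m}). f \<pi>)"
proof -
  let ?T = "PiE B (\<lambda>_. {..<m})"
  have "(\<Sum>\<pi>\<in>?T. \<Sum>q<m. f (\<pi>(\<beta> := q))) = (\<Sum>x\<in>?T \<times> {..<m}. f ((fst x)(\<beta> := snd x)))"
    by (simp add: sum.cartesian_product case_prod_beta)
  also have "\<dots> = (\<Sum>x\<in>?T \<times> {..<m}. f (fst x))"
  proof (rule sum.reindex_bij_witness[where i = "\<lambda>x. ((fst x)(\<beta> := snd x), fst x \<beta>)"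
        and j = "\<lambda>x. ((fst x)(\<beta> := snd x), fst x \<beta>)"])
    fix x assume "x \<in> ?T \<times> {..<m}"
    then show "((fst x)(\<beta> := snd x), fst x \<beta>) \<in> ?T \<times> {..<m}"
      "((fst x)(\<beta> := snd x), fst x \<beta>) \<in> ?T \<times> {..<m}"
      using \<beta> by (auto simp: PiE_iff extensional_def)
  qed auto
  also have "\<dots> = (\<Sum>\<pi>\<in>?T. \<Sum>q<m. f \<pi>)"
    by (simp add: sum.cartesian_product case_prod_beta del: sum_constant)
  finally show ?thesis by (simp add: sum_distrib_left)
qed

text \<open>Assouad's argument with \<open>m\<close>-ary blocks: the tests in one block are compared with a reference
  measure that does not depend on the value \<open>\<pi> \<beta>\<close> to be guessed.\<close>

lemma wrong_blocks_lower_bound: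
  fixes P :: "('b \<Rightarrow> nat) \<Rightarrow> 'y measure" and E :: "'b \<Rightarrow> nat \<Rightarrow> 'y set" and \<kappa> \<tau> \<delta> :: real
  assumes B: "finite B" "B \<noteq> {}" and m: "m > 0" and \<tau>: "\<tau> \<ge> 0" and \<kappa>0: "\<kappa> \<ge> 0"
    and P: "\<And>\<pi>. prob_space (P \<pi>)" "\<And>\<pi>. sets (P \<pi>) = sets \<Omega>"
    and E: "\<And>\<beta> q. \<beta> \<in> B \<Longrightarrow> q < m \<Longrightarrow> E \<beta> q \<in> sets \<Omega>"
    and disj: "\<And>\<beta>. \<beta> \<in> B \<Longrightarrow> disjoint_family_on (E \<beta>) {..<m}"
    and le: "\<And>\<pi> \<beta> q. \<pi> \<in> PiE B (\<lambda>_. {..<m}) \<Longrightarrow> \<beta> \<in> B \<Longrightarrow> q < m \<Longrightarrow>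
      measure (P (\<pi>(\<beta> := q))) (E \<beta> q) \<le> \<tau> * measure (P (\<pi>(\<beta> := m))) (E \<beta> q) + \<delta>"
    and \<kappa>: "\<tau> / real m + \<delta> \<le> 1 - \<kappa>"
  shows "\<exists>\<pi>\<in>PiE B (\<lambda>_. {..<m}).
     \<kappa> / 2 \<le> measure (P \<pi>) {y \<in> space \<Omega>. \<kappa> / 2 * real (card B) \<le> real (card {\<beta>\<in>B. y \<notin> E \<beta> (\<pi> \<beta>)})}"
proof -
  define \<Theta> where "\<Theta> = PiE B (\<lambda>_. {..<m})"
  have \<Theta>: "finite \<Theta>" "\<Theta> \<noteq> {}" using B m by (auto simp: \<Theta>_def finite_PiE PiE_eq_empty_iff)
  define f where "f \<beta> \<pi> = measure (P \<pi>) (E \<beta> (\<pi> \<beta>))" for \<beta> \<pi>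
  have f_sum: "(\<Sum>\<pi>\<in>\<Theta>. f \<beta> \<pi>) \<le> (1 - \<kappa>) * real (card \<Theta>)" if \<beta>: "\<beta> \<in> B" for \<beta>
  proof -
    have "real m * (\<Sum>\<pi>\<in>\<Theta>. f \<beta> \<pi>) = (\<Sum>\<pi>\<in>\<Theta>. \<Sum>q<m. f \<beta> (\<pi>(\<beta> := q)))"
      unfolding \<Theta>_def by (rule sum_PiE_update[OF \<beta> B(1), symmetric])
    also have "\<dots> \<le> (\<Sum>\<pi>\<in>\<Theta>. \<tau> + real m * \<delta>)"
    proof (rule sum_mono)
      fix \<pi> assume \<pi>: "\<pi> \<in> \<Theta>"
      \<comment> \<open>This reference measure is the same for all \<open>q\<close>, so the disjoint
        events share total mass at most 1. Dividing by \<open>m\<close> yields the average success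
        bound \<open>\<tau> / m + \<delta>\<close>.\<close>
      interpret Q: prob_space "P (\<pi>(\<beta> := m))" by (rule P(1))
      have "(\<Sum>q<m. f \<beta> (\<pi>(\<beta> := q))) \<le> (\<Sum>q<m. \<tau> * measure (P (\<pi>(\<beta> := m))) (E \<beta> q) + \<delta>)"
        using le \<pi> \<beta> by (intro sum_mono) (auto simp: f_def \<Theta>_def)
      also have "\<dots> = \<tau> * (\<Sum>q<m. measure (P (\<pi>(\<beta> := m))) (E \<beta> q)) + real m * \<delta>"
        by (simp add: sum.distrib sum_distrib_left)
      also have "(\<Sum>q<m. measure (P (\<pi>(\<beta> := m))) (E \<beta> q)) = measure (P (\<pi>(\<beta> := m))) (\<Union>q<m. E \<beta> q)"
        using E[OF \<beta>] disj[OF \<beta>] P(2) by (intro Q.finite_measure_finite_Union[symmetric]) auto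
      also have "\<tau> * \<dots> + real m * \<delta> \<le> \<tau> * 1 + real m * \<delta>"
        using \<tau> by (intro add_right_mono mult_left_mono) auto
      finally show "(\<Sum>q<m. f \<beta> (\<pi>(\<beta> := q))) \<le> \<tau> + real m * \<delta>" by (simp only: mult_1_right)
    qed
    also have "\<dots> = real m * ((\<tau> / real m + \<delta>) * real (card \<Theta>))" using m by (simp add: field_simps)
    also have "\<dots> \<le> real m * ((1 - \<kappa>) * real (card \<Theta>))"
      by (intro mult_left_mono mult_right_mono \<kappa>) auto
    finally show ?thesis using m by simp
  qed
  have "\<exists>\<pi>\<in>\<Theta>. \<kappa> * real (card B) \<le> (\<Sum>\<beta>\<in>B. 1 - f \<beta> \<pi>)"
  proof (rule ccontr)
    assume "\<not> ?thesis"
    then have "(\<Sum>\<pi>\<in>\<Theta>. \<Sum>\<beta>\<in>B. 1 - f \<beta> \<pi>) < (\<Sum>\<pi>\<in>\<Theta>. \<kappa> * real (card B))"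
      using \<Theta> by (intro sum_strict_mono) auto
    also have "\<dots> = (\<Sum>\<beta>\<in>B. \<kappa> * real (card \<Theta>))" by simp
    also have "\<dots> \<le> (\<Sum>\<beta>\<in>B. \<Sum>\<pi>\<in>\<Theta>. 1 - f \<beta> \<pi>)"
      using f_sum by (intro sum_mono) (simp add: sum_subtractf algebra_simps)
    also have "\<dots> = (\<Sum>\<pi>\<in>\<Theta>. \<Sum>\<beta>\<in>B. 1 - f \<beta> \<pi>)" by (rule sum.swap)
    finally show False by simp
  qed
  then obtain \<pi> where \<pi>: "\<pi> \<in> \<Theta>" "\<kappa> * real (card B) \<le> (\<Sum>\<beta>\<in>B. 1 - f \<beta> \<pi>)" by blast
  interpret P: prob_space "P \<pi>" by (rule P(1))
  have sp: "space (P \<pi>) = space \<Omega>" by (rule sets_eq_imp_space_eq[OF P(2)])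
  have E': "E \<beta> (\<pi> \<beta>) \<in> sets (P \<pi>)" if "\<beta> \<in> B" for \<beta>
    using E[OF that] \<pi>(1) that P(2) by (auto simp: \<Theta>_def PiE_iff)
  define W where "W y = (\<Sum>\<beta>\<in>B. indicator (space (P \<pi>) - E \<beta> (\<pi> \<beta>)) y :: real)" for y
  have W_meas [measurable]: "W \<in> borel_measurable (P \<pi>)"
    unfolding W_def using E' by (intro borel_measurable_sum borel_measurable_indicator) auto
  have W_card: "W y = real (card {\<beta>\<in>B. y \<notin> E \<beta> (\<pi> \<beta>)})" if "y \<in> space \<Omega>" for y
    using that B(1) by (simp add: W_def sp indicator_def sum.If_cases Int_def)
  have W_le: "W y \<le> real (card B)" for y
    unfolding W_def using sum_bounded_above[of B "\<lambda>\<beta>. indicator (space (P \<pi>) - E \<beta> (\<pi> \<beta>)) y" "1 :: real"]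
    by (simp add: indicator_def)
  have W0: "W y \<ge> 0" for y unfolding W_def by (intro sum_nonneg) simp
  define D where "D = {y \<in> space (P \<pi>). \<kappa> / 2 * real (card B) \<le> W y}"
  have D [measurable]: "D \<in> sets (P \<pi>)" unfolding D_def by measurable
  have "\<kappa> * real (card B) \<le> (\<Sum>\<beta>\<in>B. 1 - f \<beta> \<pi>)" by (rule \<pi>(2))
  also have "\<dots> = (\<Sum>\<beta>\<in>B. \<integral>y. indicator (space (P \<pi>) - E \<beta> (\<pi> \<beta>)) y \<partial>P \<pi>)"
  proof (intro sum.cong refl)
    fix \<beta> assume "\<beta> \<in> B"
    then show "1 - f \<beta> \<pi> = (\<integral>y. indicator (space (P \<pi>) - E \<beta> (\<pi> \<beta>)) y \<partial>P \<pi>)"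
      using P.prob_compl[OF E'] by (simp add: f_def Int_absorb2 Diff_subset)
  qed
  also have "\<dots> = (\<integral>y. W y \<partial>P \<pi>)"
    unfolding W_def using E'
    by (intro Bochner_Integration.integral_sum[symmetric] integrable_real_indicator) (auto simp: P.emeasure_eq_measure)
  \<comment> \<open>Reverse Markov inequality: \<open>W\<close> is at most \<open>card B\<close> on
    \<open>D\<close> and at most half its guaranteed mean off \<open>D\<close>, so \<open>D\<close>
    must carry probability at least \<open>\<kappa> / 2\<close>.\<close>
  also have "\<dots> \<le> (\<integral>y. real (card B) * indicator D y + \<kappa> / 2 * real (card B) \<partial>P \<pi>)"
  proof (rule integral_mono_AE)
    show "integrable (P \<pi>) W"
      by (rule P.integrable_const_bound[where B = "real (card B)"])
         (simp_all add: W_le W0 W_meas)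
    show "integrable (P \<pi>) (\<lambda>y. real (card B) * indicator D y + \<kappa> / 2 * real (card B))"
      using D by (intro Bochner_Integration.integrable_add integrable_mult_right integrable_real_indicator)
        (auto simp: P.emeasure_eq_measure)
    have "0 \<le> \<kappa> * real (card B)" using \<kappa>0 by simp
    then show "AE y in P \<pi>. W y \<le> real (card B) * indicator D y + \<kappa> / 2 * real (card B)"
      using W_le by (intro AE_I2) (auto simp: D_def indicator_def add_increasing2)
  qed
  also have "\<dots> = real (card B) * measure (P \<pi>) D + \<kappa> / 2 * real (card B)"
    using D by (simp add: P.emeasure_eq_measure P.prob_space)
  finally have "\<kappa> / 2 \<le> measure (P \<pi>) D" using B by (simp add: field_simps card_gt_0_iff)
  moreover have "D = {y \<in> space \<Omega>. \<kappa> / 2 * real (card B) \<le> real (card {\<beta>\<in>B. y \<notin> E \<beta> (\<pi> \<beta>)})}"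
    unfolding D_def using W_card by (auto simp: sp)
  ultimately show ?thesis using \<pi>(1) unfolding \<Theta>_def by auto
qed

text \<open>Row \<open>j < h\<close> carries \<open>r\<close> consecutive blocks of length \<open>m\<close>, starting at column \<open>h\<close>.  A block
  \<open>(j, b)\<close> with \<open>\<pi> (j, b) < m\<close> has exactly one nonzero entry, and \<open>\<pi> (j, b) = m\<close> encodes the zero block.\<close>

definition hyp_mat :: "nat \<Rightarrow> nat \<Rightarrow> nat \<Rightarrow> nat \<Rightarrow> real \<Rightarrow> (nat \<times> nat \<Rightarrow> nat) \<Rightarrow> real mat" where
  "hyp_mat d h r m a \<pi> = mat d d (\<lambda>(j, k).
     if j < h \<and> h \<le> k \<and> (k - h) div m < r \<and> (k - h) mod m = \<pi> (j, (k - h) div m) then a else 0)"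

definition block_col :: "nat \<Rightarrow> nat \<Rightarrow> nat \<Rightarrow> nat \<Rightarrow> nat" where
  "block_col h m b q = h + b * m + q"

lemma hyp_mat_carrier [simp]: "hyp_mat d h r m a \<pi> \<in> carrier_mat d d"
  by (simp add: hyp_mat_def)

lemma block_upper_hyp_mat: "block_upper h d (hyp_mat d h r m a \<pi>)"
  by (auto simp: block_upper_def hyp_mat_def split: if_splits)

lemma block_col_div_mod:
  assumes "q < m"
  shows "(block_col h m b q - h) div m = b" "(block_col h m b q - h) mod m = q" "h \<le> block_col h m b q"
  using assms by (auto simp: block_col_def)

lemma block_col_less:
  assumes "b < r" "q < m" "r * m \<le> h" "2 * h \<le> d"
  shows "block_col h m b q < d"
proof -
  have "Suc b * m \<le> r * m" using assms by (intro mult_le_mono1) auto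
  then show ?thesis using assms by (simp add: block_col_def)
qed

lemma hyp_mat_block:
  assumes "j < h" "b < r" "q < m" "r * m \<le> h" "2 * h \<le> d"
  shows "hyp_mat d h r m a \<pi> $$ (j, block_col h m b q) = (if q = \<pi> (j, b) then a else 0)"
  using assms block_col_less[OF assms(2-5)] block_col_div_mod[OF assms(3), of h b]
  by (simp add: hyp_mat_def)

text \<open>A remainder modulo \<open>m\<close> never equals \<open>m\<close>, so the value
  \<open>m\<close> empties the block, and filling position \<open>q\<close> changes a single entry,
  as the comparison of laws requires.\<close>

lemma hyp_mat_update:
  assumes "j0 < h" "b0 < r" "q < m" and jk: "j < d" "k < d"
  shows "hyp_mat d h r m a (\<pi>((j0, b0) := q)) $$ (j, k) = hyp_mat d h r m a (\<pi>((j0, b0) := m)) $$ (j, k) +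
    (if j = j0 \<and> k = block_col h m b0 q then a else 0)"
proof (cases "h \<le> k \<and> (k - h) div m = b0")
  case False
  then have "k \<noteq> block_col h m b0 q" using block_col_div_mod[OF assms(3)] by metis
  then show ?thesis using False jk by (auto simp: hyp_mat_def)
next
  case True
  have "(k - h) mod m < m" using assms(3) by simp
  moreover have "k = block_col h m b0 q \<longleftrightarrow> (k - h) mod m = q"
  proof
    assume "(k - h) mod m = q"
    then have "k - h = b0 * m + q" using True div_mult_mod_eq[of "k - h" m] by simp
    then show "k = block_col h m b0 q" using True unfolding block_col_def by linarith
  qed (use block_col_div_mod[OF assms(3)] in simp)
  ultimately show ?thesis using True jk assms(1,2) by (auto simp: hyp_mat_def)
qed

lemma l0_norm_hyp_mat:
  assumes "m > 0"
  shows "l0_norm (hyp_mat d h r m a \<pi>) \<le> h * r"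
proof -
  have "{(j, k). j < dim_row (hyp_mat d h r m a \<pi>) \<and> k < dim_col (hyp_mat d h r m a \<pi>) \<and> hyp_mat d h r m a \<pi> $$ (j, k) \<noteq> 0}
      \<subseteq> (\<lambda>(j, b). (j, block_col h m b (\<pi> (j, b)))) ` ({..<h} \<times> {..<r})"
  proof (clarify)
    fix j k assume "j < dim_row (hyp_mat d h r m a \<pi>)" "k < dim_col (hyp_mat d h r m a \<pi>)"
      "hyp_mat d h r m a \<pi> $$ (j, k) \<noteq> 0"
    then have *: "j < h" "h \<le> k" "(k - h) div m < r" "(k - h) mod m = \<pi> (j, (k - h) div m)"
      by (auto simp: hyp_mat_def split: if_splits)
    have "k = block_col h m ((k - h) div m) (\<pi> (j, (k - h) div m))"
      unfolding block_col_def *(4)[symmetric] using *(2) by (simp add: add.assoc)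
    then show "(j, k) \<in> (\<lambda>(j, b). (j, block_col h m b (\<pi> (j, b)))) ` ({..<h} \<times> {..<r})"
      using * by (intro image_eqI[where x = "(j, (k - h) div m)"]) auto
  qed
  then have "l0_norm (hyp_mat d h r m a \<pi>) \<le> card ((\<lambda>(j, b). (j, block_col h m b (\<pi> (j, b)))) ` ({..<h} \<times> {..<r}))"
    unfolding l0_norm_def by (rule card_mono[rotated]) simp
  also have "\<dots> \<le> card ({..<h} \<times> {..<r})" by (rule card_image_le) simp
  finally show ?thesis by (simp add: card_cartesian_product)
qed

text \<open>Each block in \<open>W\<close> contributes one entry of size at least \<open>a\<close>.
  Different blocks contribute different entries, since the block number is recovered from the column
  by division by \<open>m\<close>.\<close>

lemma lp_norm_ge_wrong_blocks:
  assumes p: "p \<ge> 1" and a: "a > 0" and M: "M \<in> carrier_mat d d" and h: "r * m \<le> h" "2 * h \<le> d"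
    and W: "W \<subseteq> {..<h} \<times> {..<r}"
    and wrong: "\<And>j b. (j, b) \<in> W \<Longrightarrow> \<exists>q<m. a \<le> \<bar>M $$ (j, block_col h m b q)\<bar>"
  shows "a * real (card W) powr (1 / p) \<le> lp_norm p M"
proof -
  have dim: "dim_row M = d" "dim_col M = d" using M by auto
  obtain Q where Q: "\<And>j b. (j, b) \<in> W \<Longrightarrow> Q (j, b) < m \<and> a \<le> \<bar>M $$ (j, block_col h m b (Q (j, b)))\<bar>"
  proof -
    have "\<forall>\<beta>\<in>W. \<exists>q<m. a \<le> \<bar>M $$ (fst \<beta>, block_col h m (snd \<beta>) q)\<bar>" using wrong by simp
    then obtain Q where "\<forall>\<beta>\<in>W. Q \<beta> < m \<and> a \<le> \<bar>M $$ (fst \<beta>, block_col h m (snd \<beta>) (Q \<beta>))\<bar>" by metis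
    then show ?thesis by (intro that[of Q]) (drule bspec, assumption, simp)
  qed
  define g where "g = (\<lambda>(j, b). (j, block_col h m b (Q (j, b))))"
  have inj: "inj_on g W"
  proof (rule inj_onI, clarify)
    fix j b j' b' assume *: "(j, b) \<in> W" "(j', b') \<in> W" "g (j, b) = g (j', b')"
    then have "j = j'" "block_col h m b (Q (j, b)) = block_col h m b' (Q (j', b'))" by (auto simp: g_def)
    moreover have "(block_col h m b (Q (j, b)) - h) div m = b" "(block_col h m b' (Q (j', b')) - h) div m = b'"
      using Q * by (auto intro!: block_col_div_mod)
    ultimately show "j = j' \<and> b = b'" by metis
  qed
  have img: "g ` W \<subseteq> {..<d} \<times> {..<d}"
  proof (clarify)
    fix j b j' k assume *: "(j, b) \<in> W" "(j', k) = g (j, b)"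
    then have "j < h" "b < r" "k = block_col h m b (Q (j, b))" "j' = j" using W by (auto simp: g_def)
    then show "j' \<in> {..<d} \<and> k \<in> {..<d}"
      using block_col_less[of b r "Q (j, b)" m h d] Q[OF *(1)] h by auto
  qed
  have "real (card W) * a powr p = (\<Sum>\<beta>\<in>W. a powr p)" by simp
  also have "\<dots> \<le> (\<Sum>\<beta>\<in>W. \<bar>M $$ g \<beta>\<bar> powr p)"
  proof (rule sum_mono)
    fix \<beta> assume "\<beta> \<in> W"
    then have "a \<le> \<bar>M $$ g \<beta>\<bar>" using Q by (cases \<beta>) (auto simp: g_def)
    then show "a powr p \<le> \<bar>M $$ g \<beta>\<bar> powr p" using a p by (intro powr_mono2) auto
  qed
  also have "\<dots> = (\<Sum>x\<in>g ` W. \<bar>M $$ x\<bar> powr p)" by (simp add: sum.reindex[OF inj])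
  also have "\<dots> \<le> (\<Sum>x\<in>{..<d} \<times> {..<d}. \<bar>M $$ x\<bar> powr p)" by (rule sum_mono2[OF _ img]) auto
  also have "\<dots> = (\<Sum>j<d. \<Sum>k<d. \<bar>M $$ (j, k)\<bar> powr p)" by (simp add: sum.cartesian_product)
  finally have "(real (card W) * a powr p) powr (1 / p) \<le> lp_norm p M"
    unfolding lp_norm_def dim using p by (intro powr_mono2) auto
  also have "(real (card W) * a powr p) powr (1 / p) = a * real (card W) powr (1 / p)"
    using a p by (simp add: powr_mult powr_powr)
  finally show ?thesis .
qed

section \<open>Numerical choice of the blocks and constants\<close>

text \<open>Half of the rows are used, with about \<open>s / (4 * d)\<close> blocks each, as long as
  half a row permits. The maximum with 1 covers \<open>s < 4 * d\<close>, where
  \<open>2 * d \<le> s\<close> still gives \<open>h * r \<le> s\<close>. The factor 24 is 8 times 3,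
  from \<open>s \<le> 8 * d * r\<close> and \<open>d \<le> 3 * h\<close>; the last claim combines
  \<open>d \<le> 6 * r * m\<close> with \<open>2 * d * r \<le> s\<close>.\<close>

lemma block_parameters:
  fixes d s :: nat
  assumes d: "4 \<le> d" and s: "2 * d \<le> s" "s \<le> d\<^sup>2"
  shows "\<exists>h r m. 1 \<le> h \<and> 1 \<le> r \<and> 2 \<le> m \<and> r * m \<le> h \<and> 2 * h \<le> d \<and> h * r \<le> s \<and>
    s \<le> 24 * (h * r) \<and> d\<^sup>2 \<le> 3 * m * s"
proof -
  define h where "h = d div 2"
  define x where "x = s div (4 * d)"
  define r where "r = max 1 x"
  define m where "m = h div r"
  have h: "2 \<le> h" "2 * h \<le> d" "d \<le> 2 * h + 1" using d by (auto simp: h_def)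
  have x1: "4 * d * x \<le> s" "s < 4 * d * (x + 1)"
    using d unfolding x_def by (auto simp: dividend_less_times_div mult.commute)
  have "4 * d * x \<le> d * d" by (rule order_trans[OF x1(1)]) (use s(2) in \<open>simp add: power2_eq_square\<close>)
  then have "4 * x \<le> d" using d by (simp add: mult.assoc mult.left_commute)
  then have "4 * x \<le> 2 * h + 1" using h(3) by linarith
  \<comment> \<open>Parity absorbs the 1 lost when \<open>d\<close> is halved.\<close>
  then have "2 * x \<le> h" by presburger
  then have r: "1 \<le> r" "2 * r \<le> h" using h(1) by (auto simp: r_def)
  have "2 * r div r \<le> m" unfolding m_def by (rule div_le_mono[OF r(2)])
  then have m: "2 \<le> m" using r(1) by simp
  have rm: "r * m \<le> h" unfolding m_def by simp
  have hm: "h < r * (m + 1)"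
    using r(1) dividend_less_times_div[of r h] by (simp add: m_def)
  have sr: "2 * d * r \<le> s" using x1(1) s(1) by (auto simp: r_def max_def)
  have "x + 1 \<le> 2 * r" by (auto simp: r_def)
  then have "4 * d * (x + 1) \<le> 4 * d * (2 * r)" by (rule mult_le_mono2)
  then have s8: "s \<le> 8 * d * r" using x1(2) by simp
  have d3: "d \<le> 3 * h" using h by linarith
  have "h * r \<le> 2 * d * r" using h(2) by (intro mult_le_mono1) linarith
  then have hr: "h * r \<le> s" using sr by linarith
  have "8 * d * r \<le> 8 * (3 * h) * r" using d3 by (intro mult_le_mono1 mult_le_mono2)
  then have s24: "s \<le> 24 * (h * r)" using s8 by linarith
  have "r * (m + 1) \<le> r * (2 * m)" using m by (intro mult_le_mono2) simp
  then have "h \<le> 2 * (r * m)" using hm by linarith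
  then have "d * d \<le> d * (3 * (2 * (r * m)))" using d3 by (intro mult_le_mono2) linarith
  also have "\<dots> = 3 * m * (2 * d * r)" by simp
  also have "\<dots> \<le> 3 * m * s" by (rule mult_le_mono2[OF sr])
  finally have "d\<^sup>2 \<le> 3 * m * s" by (simp add: power2_eq_square)
  then show ?thesis using h r m rm hr s24 by (intro exI[of _ h] exI[of _ r] exI[of _ m]) auto
qed

text \<open>The argument of the logarithm is at most \<open>9 * m\<close>, and
  \<open>m \<ge> 2\<close> turns the constant into a power:
  \<open>9 \<le> 2 ^ 4 \<le> m ^ 4\<close>.\<close>

lemma ln_rate_le:
  fixes d s m :: nat
  assumes m: "2 \<le> m" and s: "0 < s" and d: "d\<^sup>2 \<le> 3 * m * s"
  shows "ln (exp 1 * (real d)\<^sup>2 / real s) \<le> 5 * ln (real m)"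
\<comment> \<open>For \<open>d = 0\<close> the left side is \<open>ln 0\<close>, which is 0 by
  convention.\<close>
proof (cases "d = 0")
  case False
  have "real (d\<^sup>2) \<le> real (3 * m * s)" using d by (simp only: of_nat_le_iff)
  then have "(real d)\<^sup>2 / real s \<le> 3 * real m" using s by (simp add: divide_le_eq)
  then have "exp 1 * ((real d)\<^sup>2 / real s) \<le> 3 * (3 * real m)"
    using exp_le by (intro mult_mono) auto
  also have "\<dots> \<le> 2 ^ 4 * real m" by simp
  also have "\<dots> \<le> real m ^ 4 * real m" using m by (intro mult_right_mono power_mono) auto
  finally have "exp 1 * (real d)\<^sup>2 / real s \<le> real m ^ 5" by (simp add: power_numeral_reduce mult.commute)
  then have "ln (exp 1 * (real d)\<^sup>2 / real s) \<le> ln (real m ^ 5)"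
    using False s by (intro ln_mono) auto
  also have "\<dots> = 5 * ln (real m)" using m by (simp add: ln_realpow)
  finally show ?thesis .
qed (use m in simp)

text \<open>With \<open>x = ln m\<close> the first term is the inverse square root of
  \<open>m\<close>, at most 0.71. Since \<open>a\<^sup>2 * N = x / 400\<close>, the second is
  \<open>1 / 100 + 1 / (25 * x)\<close>, at most 0.09 because \<open>x \<ge> 1 / 2\<close>.\<close>

lemma testing_constants:
  fixes m :: nat and a :: real
  assumes m: "2 \<le> m" and N: "0 < N" and a: "a = sqrt (ln (real m) / real N) / 20"
  shows "exp (ln (real m) / 2) / real m +
    (2 / (ln (real m) / 2) + 4 / (ln (real m) / 2)\<^sup>2) * (a\<^sup>2 * real N) \<le> 1 - 1 / 5"
proof -
  define x where "x = ln (real m)"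
  have "1 / 2 \<le> ln (2 :: real)" using ln2_ge_two_thirds by simp
  also have "\<dots> \<le> x" using m by (simp add: x_def)
  finally have x: "1 / 2 \<le> x" .
  have em: "exp x = real m" using m by (simp add: x_def)
  have aN: "a\<^sup>2 * real N = x / 400"
    using x N unfolding a x_def by (simp add: power_divide)
  have "(2 / (x / 2) + 4 / (x / 2)\<^sup>2) * (a\<^sup>2 * real N) = 1 / 100 + 1 / (25 * x)"
    unfolding aN using x by (simp add: field_simps power2_eq_square)
  also have "\<dots> \<le> 1 / 100 + 2 / 25" using x by (simp add: field_simps)
  finally have 1: "(2 / (x / 2) + 4 / (x / 2)\<^sup>2) * (a\<^sup>2 * real N) \<le> 9 / 100" by simp
  have "exp (x / 2) / real m = exp (- (x / 2))"
    unfolding em[symmetric] exp_diff[symmetric] by simp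
  also have "\<dots> \<le> 71 / 100"
  proof -
    have "exp (- (x / 2)) ^ 2 = exp (- x)" by (simp add: exp_of_nat_mult[symmetric])
    also have "\<dots> = 1 / real m" by (simp add: exp_minus em divide_inverse)
    also have "\<dots> \<le> 1 / 2" using m by (simp add: field_simps)
    also have "\<dots> \<le> (71 / 100)\<^sup>2" by (simp add: power2_eq_square)
    finally show ?thesis by (rule power2_le_imp_le) simp
  qed
  finally show ?thesis using 1 unfolding x_def by linarith
qed

text \<open>The constant is 240 times 120. A tenth of the \<open>B\<close> blocks is wrong and
  \<open>B\<close> is at least \<open>s / 24\<close>, which gives 240; as \<open>p \<ge> 1\<close>,
  the root of 1/240 is at least 1/240, so the constant does not depend on \<open>p\<close>. The 120
  compares \<open>a / 2\<close> with the bound \<open>60 * a\<close> for the square root in the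
  rate.\<close>

lemma rate_le:
  assumes d: "4 \<le> d" and s: "2 * d \<le> s" "s \<le> d\<^sup>2" and N: "1 \<le> N" and p: "1 \<le> p" and m: "2 \<le> m"
    and dm: "d\<^sup>2 \<le> 3 * m * s" and B: "s \<le> 24 * B" and a: "a = sqrt (ln (real m) / real N) / 20"
    and W: "real B / 10 \<le> real W"
  shows "0 < rate p N d s" "rate p N d s / 28800 \<le> a / 2 * real W powr (1 / p)"
proof -
  define L where "L = ln (exp 1 * (real d)\<^sup>2 / real s)"
  have s0: "0 < s" using s d by linarith
  have "real s \<le> (real d)\<^sup>2" using s(2) by (metis of_nat_le_iff of_nat_power)
  then have "exp 1 \<le> exp 1 * (real d)\<^sup>2 / real s" using s0 by (simp add: field_simps)
  then have "ln (exp 1) \<le> L" unfolding L_def by (intro ln_mono) auto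
  then have L: "1 \<le> L" by simp
  show "0 < rate p N d s" unfolding rate_def L_def[symmetric] using s0 L N by (simp add: zero_less_mult_iff)
  have "sqrt (1 / real N * L) \<le> sqrt (9 * (ln (real m) / real N))"
  proof (rule real_sqrt_le_mono)
    have "L \<le> 5 * ln (real m)" unfolding L_def by (rule ln_rate_le[OF m s0 dm])
    \<comment> \<open>The factor 5 is raised to the next perfect square, so that the root is
      rational.\<close>
    also have "\<dots> \<le> 9 * ln (real m)" using m by simp
    finally show "1 / real N * L \<le> 9 * (ln (real m) / real N)" using N by (simp add: field_simps)
  qed
  also have "\<dots> = 60 * a"
  proof -
    have "sqrt 9 = (3 :: real)" by (rule real_sqrt_unique) auto
    then show ?thesis unfolding a real_sqrt_mult by simp
  qed
  finally have 1: "sqrt (1 / real N * L) \<le> 60 * a" .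
  have "(real s / 240) powr (1 / p) \<le> real W powr (1 / p)"
  proof (rule powr_mono2)
    have "real s \<le> real (24 * B)" using B by (simp only: of_nat_le_iff)
    then show "real s / 240 \<le> real W" using W by simp
  qed (use p in auto)
  moreover have "(real s / 240) powr (1 / p) = real s powr (1 / p) * (1 / 240) powr (1 / p)"
    using powr_mult[of "real s" "1 / 240" "1 / p"] by simp
  moreover have "(1 / 240) powr 1 \<le> (1 / 240 :: real) powr (1 / p)"
    using p by (intro powr_mono') auto
  ultimately have 2: "real s powr (1 / p) * (1 / 240) \<le> real W powr (1 / p)"
    by (smt (verit) mult_left_mono powr_ge_zero powr_one)
  have "rate p N d s / 28800 = real s powr (1 / p) * (1 / 240) * (sqrt (1 / real N * L) / 120)"
    unfolding rate_def L_def by simp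
  also have "\<dots> \<le> real W powr (1 / p) * (60 * a / 120)"
    using 1 2 by (intro mult_mono divide_right_mono) (use L N in auto)
  finally show "rate p N d s / 28800 \<le> a / 2 * real W powr (1 / p)" by (simp add: mult.commute)
qed

section \<open>Minimax bound for an arbitrary monotone loss\<close>

theorem proposition3p5:
  fixes l :: "real \<Rightarrow> real"
  assumes "mono_on {0..} l" and "\<forall>u\<ge>0. l u \<ge> 0" and "l 0 = 0" and "\<exists>u\<ge>0. l u \<noteq> 0"
  shows "\<exists>c>0. \<exists>c'>0. \<forall>(d::nat) (s::nat) (N::nat) (p::real) P.
    4 \<le> d \<longrightarrow> 2 * d \<le> s \<longrightarrow> s \<le> d\<^sup>2 \<longrightarrow> 1 \<le> N \<longrightarrow> 1 \<le> p \<longrightarrow>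
    (\<forall>A\<in>carrier_mat d d. ou_law N d 1 (\<lambda>i. 0\<^sub>v d) A (P A)) \<longrightarrow>
    ennreal c' \<le>
      (INF Ahat\<in>estimators N d 1. SUP A\<in>{A \<in> carrier_mat d d. l0_norm A \<le> s}.
         \<integral>\<^sup>+y. ennreal (l (c * inverse (rate p N d s) * lp_norm p (Ahat y - A))) \<partial>P A)"
proof -
  \<comment> \<open>Any point of positive loss determines both constants:
    \<open>c = 28800 * u\<close> pushes the argument of the loss to at least \<open>u\<close> on the
    bad event, and \<open>c' = l u / 10\<close> is the loss there times its probability.\<close>
  obtain u where "u \<ge> 0" "l u \<noteq> 0" using assms(4) by blast
  then have u: "u > 0" "l u > 0" using assms(2,3) by (auto simp: less_le)
  have "ennreal (l u / 10) \<le>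
      (INF Ahat\<in>estimators N d 1. SUP A\<in>{A \<in> carrier_mat d d. l0_norm A \<le> s}.
         \<integral>\<^sup>+y. ennreal (l (28800 * u * inverse (rate p N d s) * lp_norm p (Ahat y - A))) \<partial>P A)"
    if d: "4 \<le> d" and s: "2 * d \<le> s" "s \<le> d\<^sup>2" and N: "1 \<le> N" and p: "1 \<le> p"
      and law: "\<forall>A\<in>carrier_mat d d. ou_law N d 1 (\<lambda>i. 0\<^sub>v d) A (P A)"
    for d s N :: nat and p :: real and P
  proof (rule INF_greatest)
    fix Ahat assume Ahat: "Ahat \<in> estimators N d 1"
    let ?\<Omega> = "obs_space N d 1"
    from block_parameters[OF d s] obtain h r m where hrm: "1 \<le> h" "1 \<le> r" "2 \<le> m" "r * m \<le> h" "2 * h \<le> d"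
      "h * r \<le> s" "s \<le> 24 * (h * r)" "d\<^sup>2 \<le> 3 * m * s" by blast
    define a where "a = sqrt (ln (real m) / real N) / 20"
    have a: "a > 0" using hrm N by (simp add: a_def)
    define A where "A = hyp_mat d h r m a"
    define t where "t = ln (real m) / 2"
    have t: "t > 0" using hrm by (simp add: t_def)
    define B where "B = {..<h} \<times> {..<r}"
    have B: "finite B" "B \<noteq> {}" "card B = h * r" using hrm
      by (auto simp: B_def card_cartesian_product lessThan_empty_iff)
    \<comment> \<open>The estimator accepts position \<open>q\<close> when its whole block is
      entrywise within \<open>a / 2\<close> of the block with entry \<open>a\<close> at
      \<open>q\<close>. Distinct positions differ by \<open>a\<close> in some entry, so acceptance
      is exclusive; failure to accept the truth exhibits an entry with error at least
      \<open>a / 2\<close>.\<close>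
    define E where "E = (\<lambda>(j, b) q. {y \<in> space ?\<Omega>. \<forall>q'\<in>{..<m}.
      \<bar>Ahat y $$ (j, block_col h m b q') - (if q' = q then a else 0)\<bar> < a / 2})"
    have A_law: "ou_law N d 1 (\<lambda>i. 0\<^sub>v d) (A \<pi>) (P (A \<pi>))" for \<pi>
      using law by (simp add: A_def)
    have sets_P: "sets (P (A \<pi>)) = sets ?\<Omega>" and prob_P: "prob_space (P (A \<pi>))" for \<pi>
      using A_law[of \<pi>] by (auto simp: ou_law_def)
    have E_sets: "E \<beta> q \<in> sets ?\<Omega>" if \<beta>: "\<beta> \<in> B" for \<beta> q
    proof -
      obtain j b where jb: "\<beta> = (j, b)" "j < h" "b < r" using \<beta> by (auto simp: B_def)
      have [measurable]: "(\<lambda>y. Ahat y $$ (j, block_col h m b q')) \<in> borel_measurable ?\<Omega>" if "q' \<in> {..<m}" for q'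
        using Ahat jb hrm block_col_less[of b r q' m h d] that by (auto simp: estimators_def)
      show ?thesis unfolding E_def jb(1) prod.case by measurable
    qed
    have disj: "disjoint_family_on (E \<beta>) {..<m}" for \<beta>
      unfolding disjoint_family_on_def
    proof (intro ballI impI, rule ccontr)
      fix q q' assume q: "q \<in> {..<m}" "q' \<in> {..<m}" "q \<noteq> q'" "E \<beta> q \<inter> E \<beta> q' \<noteq> {}"
      obtain j b where jb: "\<beta> = (j, b)" by (cases \<beta>)
      obtain y where "y \<in> E (j, b) q" "y \<in> E (j, b) q'" using q jb by auto
      then have "\<bar>Ahat y $$ (j, block_col h m b q) - a\<bar> < a / 2" "\<bar>Ahat y $$ (j, block_col h m b q)\<bar> < a / 2"
        using q(1,3) by (auto simp: E_def dest!: bspec[where x = q])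
      then show False by linarith
    qed
    \<comment> \<open>Here \<kappa> is 1/5, the gap left by the success bound 4/5; half of it is
      both the fraction of wrong blocks and the probability of having that many.\<close>
    have "\<exists>\<pi>\<in>PiE B (\<lambda>_. {..<m}). 1 / 5 / 2 \<le> measure (P (A \<pi>))
        {y \<in> space ?\<Omega>. 1 / 5 / 2 * real (card B) \<le> real (card {\<beta>\<in>B. y \<notin> E \<beta> (\<pi> \<beta>)})}"
    proof (rule wrong_blocks_lower_bound)
      fix \<pi> \<beta> q assume \<beta>: "\<beta> \<in> B" and q: "q < m"
      obtain j b where jb: "\<beta> = (j, b)" "j < h" "b < r" using \<beta> by (auto simp: B_def)
      show "measure (P (A (\<pi>(\<beta> := q)))) (E \<beta> q) \<le>
          exp t * measure (P (A (\<pi>(\<beta> := m)))) (E \<beta> q) + (2 / t + 4 / t\<^sup>2) * (a\<^sup>2 * real N)"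
        unfolding jb(1)
      proof (rule ou_law_measure_le[OF A_law A_law N _ jb(2) _ _ _ t])
        show "block_upper h d (A (\<pi>((j, b) := m)))" by (simp add: A_def block_upper_hyp_mat)
        show "h \<le> block_col h m b q" by (rule block_col_div_mod(3)[OF q])
        show "block_col h m b q < d" by (rule block_col_less[OF jb(3) q hrm(4,5)])
        show "A (\<pi>((j, b) := q)) $$ (i, k) = A (\<pi>((j, b) := m)) $$ (i, k) +
            (if i = j \<and> k = block_col h m b q then a else 0)" if "i < d" "k < d" for i k
          unfolding A_def by (rule hyp_mat_update[OF jb(2,3) q that])
        show "E (j, b) q \<in> sets ?\<Omega>" using E_sets[OF \<beta>] jb(1) by simp
      qed
    next
      show "exp t / real m + (2 / t + 4 / t\<^sup>2) * (a\<^sup>2 * real N) \<le> 1 - 1 / 5"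
        unfolding t_def using hrm N by (intro testing_constants) (auto simp: a_def)
    qed (use B hrm sets_P prob_P E_sets disj in auto)
    then obtain \<pi> where \<pi>: "\<pi> \<in> PiE B (\<lambda>_. {..<m})" "1 / 10 \<le> measure (P (A \<pi>))
        {y \<in> space ?\<Omega>. real (card B) / 10 \<le> real (card {\<beta>\<in>B. y \<notin> E \<beta> (\<pi> \<beta>)})}"
      by auto
    interpret prob_space "P (A \<pi>)" by (rule prob_P)
    define D where "D = {y \<in> space ?\<Omega>. real (card B) / 10 \<le> real (card {\<beta>\<in>B. y \<notin> E \<beta> (\<pi> \<beta>)})}"
    have PD: "1 / 10 \<le> measure (P (A \<pi>)) D" unfolding D_def by (rule \<pi>(2))
    \<comment> \<open>\<open>measure\<close> is 0 outside the sigma-algebra, so a positive value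
      certifies measurability.\<close>
    then have D: "D \<in> sets (P (A \<pi>))"
      using measure_notin_sets[of D "P (A \<pi>)"] by auto
    have loss: "l u \<le> l (28800 * u * inverse (rate p N d s) * lp_norm p (Ahat y - A \<pi>))" if y: "y \<in> D" for y
    proof -
      define W where "W = {\<beta>\<in>B. y \<notin> E \<beta> (\<pi> \<beta>)}"
      have y_sp: "y \<in> space ?\<Omega>" and W: "real (h * r) / 10 \<le> real (card W)"
        using y B(3) by (auto simp: D_def W_def)
      have Ay: "Ahat y \<in> carrier_mat d d" using Ahat y_sp by (simp add: estimators_def)
      have "a / 2 * real (card W) powr (1 / p) \<le> lp_norm p (Ahat y - A \<pi>)"
      proof (rule lp_norm_ge_wrong_blocks[OF p _ _ hrm(4,5)])
        show "Ahat y - A \<pi> \<in> carrier_mat d d"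
          unfolding A_def by (rule minus_carrier_mat[OF hyp_mat_carrier])
        show "W \<subseteq> {..<h} \<times> {..<r}" by (auto simp: W_def B_def)
        fix j b assume jbW: "(j, b) \<in> W"
        then have jb: "j < h" "b < r" "y \<notin> E (j, b) (\<pi> (j, b))" by (auto simp: W_def B_def)
        then obtain q where q: "q < m" "a / 2 \<le> \<bar>Ahat y $$ (j, block_col h m b q) - (if q = \<pi> (j, b) then a else 0)\<bar>"
          using y_sp by (auto simp: E_def not_less)
        have "(Ahat y - A \<pi>) $$ (j, block_col h m b q) = Ahat y $$ (j, block_col h m b q) - (if q = \<pi> (j, b) then a else 0)"
          using jb hrm(5) block_col_less[OF jb(2) q(1) hrm(4,5)] hyp_mat_block[OF jb(1,2) q(1) hrm(4,5), of a \<pi>] Ay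
          by (subst index_minus_mat) (auto simp: A_def hyp_mat_def)
        then show "\<exists>q<m. a / 2 \<le> \<bar>(Ahat y - A \<pi>) $$ (j, block_col h m b q)\<bar>" using q by auto
      qed (use a in simp)
      then have lp: "rate p N d s / 28800 \<le> lp_norm p (Ahat y - A \<pi>)"
        using rate_le(2)[OF d s N p hrm(3,8,7) a_def W] by linarith
      have "rate p N d s > 0" by (rule rate_le(1)[OF d s N p hrm(3,8,7) a_def W])
      \<comment> \<open>Monotonicity is all that is known about \<open>l\<close>, so its argument
        has to be brought above the fixed point \<open>u\<close>.\<close>
      then have "u \<le> 28800 * u * inverse (rate p N d s) * lp_norm p (Ahat y - A \<pi>)"
        using lp u(1) by (simp add: field_simps)
      then show ?thesis using u(1) by (intro mono_onD[OF assms(1)]) auto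
    qed
    have "ennreal (l u / 10) \<le> ennreal (l u * measure (P (A \<pi>)) D)"
      using PD u(2) by (intro ennreal_leI) simp
    also have "\<dots> = (\<integral>\<^sup>+y. ennreal (l u) * indicator D y \<partial>P (A \<pi>))"
      using D u(2) by (simp add: nn_integral_cmult_indicator emeasure_eq_measure ennreal_mult)
    also have "\<dots> \<le> (\<integral>\<^sup>+y. ennreal (l (28800 * u * inverse (rate p N d s) * lp_norm p (Ahat y - A \<pi>))) \<partial>P (A \<pi>))"
      using loss by (intro nn_integral_mono) (auto simp: indicator_def intro!: ennreal_leI)
    also have "\<dots> \<le> (SUP A\<in>{A \<in> carrier_mat d d. l0_norm A \<le> s}.
         \<integral>\<^sup>+y. ennreal (l (28800 * u * inverse (rate p N d s) * lp_norm p (Ahat y - A))) \<partial>P A)"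
    proof (rule SUP_upper)
      have "l0_norm (A \<pi>) \<le> h * r" unfolding A_def using hrm by (intro l0_norm_hyp_mat) auto
      then show "A \<pi> \<in> {A \<in> carrier_mat d d. l0_norm A \<le> s}" using hrm(6) by (simp add: A_def)
    qed
    finally show "ennreal (l u / 10) \<le> (SUP A\<in>{A \<in> carrier_mat d d. l0_norm A \<le> s}.
         \<integral>\<^sup>+y. ennreal (l (28800 * u * inverse (rate p N d s) * lp_norm p (Ahat y - A))) \<partial>P A)" .
  qed
  then show ?thesis using u by (intro exI[of _ "28800 * u"] exI[of _ "l u / 10"] conjI allI impI) auto
qed

end
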